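(* A continuous shock generation point $(x,t)\in\mathbb{R}\times\mathbb{R}^+$ must be the point $(x_p,t_p)$, $x_p=x_0+t_pf'(c)$, $t_p=t_p(x_0,c)\in(0,\infty)$, of some characteristic $L_c(x_0)$ with $x_0\in\mathbb R$, $c\in\mathcal{C}(x_0)$. Moreover, for $c\in\mathcal C(x_0)$, the point $(x_p,t_p)$ is a continuous shock generation point if and only if $t_p\in(0,\infty)$ and $$\Phi(x_0+l)-\Phi(x_0)-c\,l>\big(\rho((f')^{-1}(f'(c)-l/t_p),c)-c\big)\,l\qquad\text{for all } l\neq0 \text{ of the form } l=t_p(f'(c)-f'(u)),\ u\in\mathbb{R}.$$ Furthermore, under the asymptotic assumptions $f''(u)=(N_\pm+o(1))|u-c|^{\alpha_\pm}$ as $u\to c\pm$ and $\varphi(x_0+l)-c=(C_{\gamma_\pm}+o(1))\,\mathrm{sgn}(l)|l|^{\gamma_\pm}$ as $l\to0\pm$, with constants $\alpha_\pm\ge0$, $\gamma_\pm>0$, $N_\pm>0$, $C_{\gamma_\pm}\ne0$, the following hold: (i) Let $\overline{\mathrm D}_-\Phi(x_0)<\underline{\mathrm D}_+\Phi(x_0)$. (a) If $c=\overline{\mathrm D}_-\Phi(x_0)\in\mathcal{C}(x_0)$ (and the assumptions hold for $f''$ as $u\to c+$ and $\varphi$ as $l\to0-$), then $t_p\in(0,\infty)$ if and only if $C_{\gamma_-}<0$ and $\gamma_-(1+\alpha_+)=1$; and if $t_p\in(0,\infty)$, then $t_p=t_p^-=(\gamma_-N_+|C_{\gamma_-}|^{1+\alpha_+})^{-1}$.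 (b) If $c=\underline{\mathrm D}_+\Phi(x_0)\in\mathcal{C}(x_0)$ (and the assumptions hold for $f''$ as $u\to c-$ and $\varphi$ as $l\to0+$), then $t_p\in(0,\infty)$ if and only if $C_{\gamma_+}<0$ and $\gamma_+(1+\alpha_-)=1$; and if $t_p\in(0,\infty)$, then $t_p=t_p^+=(\gamma_+N_-|C_{\gamma_+}|^{1+\alpha_-})^{-1}$. (ii) Let $\overline{\mathrm D}_-\Phi(x_0)=\underline{\mathrm D}_+\Phi(x_0)$ (with the assumptions on both sides). Then, for each sign, $t_p^\pm\in(0,\infty)$ if and only if $C_{\gamma_\pm}<0$ and $\gamma_\pm(1+\alpha_\mp)=1$; and if $t_p^\pm\in(0,\infty)$, then $t_p^\pm=(\gamma_\pm N_\mp|C_{\gamma_\pm}|^{1+\alpha_\mp})^{-1}$. Furthermore, if $t_p=\min\{t_p^+,t_p^-\}\in(0,\infty)$, then $t_p=(\gamma_-N_+|C_{\gamma_-}|^{1+\alpha_+})^{-1}$ if $t_p^-\in(0,\infty)$ and $t_p^+=\infty$; $t_p=(\gamma_+N_-|C_{\gamma_+}|^{1+\alpha_-})^{-1}$ if $t_p^+\in(0,\infty)$ and $t_p^-=\infty$; and $t_p=\min\{(\gamma_+N_-|C_{\gamma_+}|^{1+\alpha_-})^{-1},(\gamma_-N_+|C_{\gamma_-}|^{1+\alpha_+})^{-1}\}$ if $t_p^+,t_p^-\in(0,\infty)$.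
   Context: Setting: $f\in C^2(\mathbb{R})$, $f''\ge0$, $\mathcal{L}\{f''=0\}=0$, so $f'$ is strictly increasing; $\varphi\in L^\infty(\mathbb{R})$; $\mathbb R^+=(0,\infty)$. For $t>0$: $E(u;x,t)=t\int_0^u f''(s)(\varphi(x-tf'(s))-s)\,ds$; $\mathcal{U}(x,t)$ is the (nonempty compact) set of maximizers of $E(\cdot\,;x,t)$. The entropy solution of $u_t+f(u)_x=0$, $u|_{t=0}=\varphi$ is $u(x,t)=\inf\mathcal{U}(x,t)$, with traces $u(x-,t)=\sup\mathcal{U}(x,t)$, $u(x+,t)=\inf\mathcal{U}(x,t)$. $L_c(x_0)=\{(x,t): x=x_0+tf'(c),\ t>0\}$; $\mathcal{C}(x_0)=\{c: c\in\mathcal{U}(x,t)\text{ for some }(x,t)\in L_c(x_0)\}$ (then $L_c(x_0)$ is called a characteristic). $\Phi(x)=\int_0^x\varphi\,d\xi$, $\overline{\mathrm D}_-\Phi(x_0)=\limsup_{l\to0-}\frac1l(\Phi(x_0+l)-\Phi(x_0))$, $\underline{\mathrm D}_+\Phi(x_0)=\liminf_{l\to0+}\frac1l(\Phi(x_0+l)-\Phi(x_0))$. For $c\in\mathcal{C}(x_0)$: $t_p^\pm(x_0,c)=\sup\{t>0: \Phi(l;x_0,c)>F(l;t,c)\text{ for all sufficiently small }\pm l>0\}\in(0,\infty]$, $t_p=\min\{t_p^+,t_p^-\}$, where $\Phi(l;x_0,c)=\int_{x_0}^{x_0+l}(\varphi-c)\,d\xi$, $F(l;t,c)=-t\int_c^{u(l;t,c)}(s-c)f''(s)\,ds$,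 $u(l;t,c)=(f')^{-1}(f'(c)-l/t)$. $\rho(u,v)=\int_v^usf''(s)\,ds\big/\int_v^uf''(s)\,ds$ for $u\ne v$, $\rho(v,v)=v$. Restart at time $\tau>0$: for $t>\tau$, $E(v;x,t;\tau)=(t-\tau)\int_0^vf''(s)\big(u(x-(t-\tau)f'(s),\tau)-s\big)\,ds$, $\mathcal{U}(x,t;\tau)$ its set of maximizers in $v$, $\mathcal{C}_\tau(x)=\{c: c\in\mathcal{U}(x+(t-\tau)f'(c),t;\tau)\text{ for some }t>\tau\}$. A point $(x,t)$, $t>0$, is a continuous shock generation point if $u(x-,t)=u(x+,t)$ and $\mathcal{C}_t(x)=\varnothing$ (equivalently, $u$ is continuous there and a shock emits from it).
   Formalization: In the "if and only if", "(x_p,t_p) is a continuous shock generation point" is taken to include c ∈ U(x_p,t_p), i.e. the characteristic L_c(x_0) still carries its value there; without this the claim fails when L_c(x_0) was absorbed by a shock earlier. *)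

theory Defs
  imports "HOL-Analysis.Analysis" "HOL-Library.Landau_Symbols"
begin

text \<open>
  Throughout, \<open>f\<close> is the flux and \<open>\<phi>\<close> the initial datum of \<open>u\<^sub>t + f(u)\<^sub>x = 0\<close>.
  All integrals are oriented integrals with respect to \<open>lebesgue\<close> rather than \<open>lborel\<close>, since
  \<open>\<phi>\<close> is only assumed Lebesgue measurable and the Bochner integral of a function that is not
  measurable for the given measure is \<open>0\<close>.
\<close>

definition C2_fun :: "(real \<Rightarrow> real) \<Rightarrow> bool" where
  "C2_fun f \<longleftrightarrow> (\<forall>x. f differentiable at x) \<and> (\<forall>x. deriv f differentiable at x)
     \<and> continuous_on UNIV (deriv (deriv f))"

definition Linfty_fun :: "(real \<Rightarrow> real) \<Rightarrow> bool" where
  "Linfty_fun \<phi> \<longleftrightarrow> \<phi> \<in> borel_measurable lebesgue \<and> (\<exists>M. AE x in lebesgue. \<bar>\<phi> x\<bar> \<le> M)"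

definition E_fun :: "(real \<Rightarrow> real) \<Rightarrow> (real \<Rightarrow> real) \<Rightarrow> real \<Rightarrow> real \<Rightarrow> real \<Rightarrow> real" where
  "E_fun f \<phi> u x t =
     t * (LINT s=ereal 0..ereal u|lebesgue. (deriv (deriv f) s * (\<phi> (x - t * deriv f s) - s)))"

definition maximizers :: "(real \<Rightarrow> real) \<Rightarrow> (real \<Rightarrow> real) \<Rightarrow> real \<Rightarrow> real \<Rightarrow> real set" where
  "maximizers f \<phi> x t = {u. \<forall>v. E_fun f \<phi> v x t \<le> E_fun f \<phi> u x t}"

definition entropy_sol :: "(real \<Rightarrow> real) \<Rightarrow> (real \<Rightarrow> real) \<Rightarrow> real \<Rightarrow> real \<Rightarrow> real" where
  "entropy_sol f \<phi> x t = Inf (maximizers f \<phi> x t)"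

definition trace_left :: "(real \<Rightarrow> real) \<Rightarrow> (real \<Rightarrow> real) \<Rightarrow> real \<Rightarrow> real \<Rightarrow> real" where
  "trace_left f \<phi> x t = Sup (maximizers f \<phi> x t)"

definition trace_right :: "(real \<Rightarrow> real) \<Rightarrow> (real \<Rightarrow> real) \<Rightarrow> real \<Rightarrow> real \<Rightarrow> real" where
  "trace_right f \<phi> x t = Inf (maximizers f \<phi> x t)"

definition char_line :: "(real \<Rightarrow> real) \<Rightarrow> real \<Rightarrow> real \<Rightarrow> (real \<times> real) set" where
  "char_line f c x0 = {(x, t). x = x0 + t * deriv f c \<and> t > 0}"

definition char_values :: "(real \<Rightarrow> real) \<Rightarrow> (real \<Rightarrow> real) \<Rightarrow> real \<Rightarrow> real set" where
  "char_values f \<phi> x0 = {c. \<exists>(x, t) \<in> char_line f c x0. c \<in> maximizers f \<phi> x t}"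

definition Phi :: "(real \<Rightarrow> real) \<Rightarrow> real \<Rightarrow> real" where
  "Phi \<phi> x = (LINT \<xi>=ereal 0..ereal x|lebesgue. \<phi> \<xi>)"

definition upper_left_Dini :: "(real \<Rightarrow> real) \<Rightarrow> real \<Rightarrow> ereal" where
  "upper_left_Dini g x0 = Limsup (at_left 0) (\<lambda>l. ereal ((g (x0 + l) - g x0) / l))"

definition lower_right_Dini :: "(real \<Rightarrow> real) \<Rightarrow> real \<Rightarrow> ereal" where
  "lower_right_Dini g x0 = Liminf (at_right 0) (\<lambda>l. ereal ((g (x0 + l) - g x0) / l))"

definition Phi_loc :: "(real \<Rightarrow> real) \<Rightarrow> real \<Rightarrow> real \<Rightarrow> real \<Rightarrow> real" where
  "Phi_loc \<phi> l x0 c = (LINT \<xi>=ereal x0..ereal (x0 + l)|lebesgue. (\<phi> \<xi> - c))"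

text \<open>
  The value \<open>(f')\<^sup>-\<^sup>1(f'(c) - l/t)\<close>. It is meaningful only if \<open>f'(c) - l/t\<close> lies in the range of
  \<open>f'\<close>; that range is open, so this holds for all sufficiently small \<open>l\<close>.
\<close>

definition u_loc :: "(real \<Rightarrow> real) \<Rightarrow> real \<Rightarrow> real \<Rightarrow> real \<Rightarrow> real" where
  "u_loc f l t c = inv (deriv f) (deriv f c - l / t)"

definition F_loc :: "(real \<Rightarrow> real) \<Rightarrow> real \<Rightarrow> real \<Rightarrow> real \<Rightarrow> real" where
  "F_loc f l t c =
     - t * (LINT s=ereal c..ereal (u_loc f l t c)|lebesgue. ((s - c) * deriv (deriv f) s))"

definition tp_plus :: "(real \<Rightarrow> real) \<Rightarrow> (real \<Rightarrow> real) \<Rightarrow> real \<Rightarrow> real \<Rightarrow> ereal" where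
  "tp_plus f \<phi> x0 c =
     Sup (ereal ` {t. t > 0 \<and> (\<forall>\<^sub>F l in at_right 0. Phi_loc \<phi> l x0 c > F_loc f l t c)})"

definition tp_minus :: "(real \<Rightarrow> real) \<Rightarrow> (real \<Rightarrow> real) \<Rightarrow> real \<Rightarrow> real \<Rightarrow> ereal" where
  "tp_minus f \<phi> x0 c =
     Sup (ereal ` {t. t > 0 \<and> (\<forall>\<^sub>F l in at_left 0. Phi_loc \<phi> l x0 c > F_loc f l t c)})"

definition tp :: "(real \<Rightarrow> real) \<Rightarrow> (real \<Rightarrow> real) \<Rightarrow> real \<Rightarrow> real \<Rightarrow> ereal" where
  "tp f \<phi> x0 c = min (tp_plus f \<phi> x0 c) (tp_minus f \<phi> x0 c)"

definition rho :: "(real \<Rightarrow> real) \<Rightarrow> real \<Rightarrow> real \<Rightarrow> real" where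
  "rho f u v = (if u = v then v
     else (LINT s=ereal v..ereal u|lebesgue. (s * deriv (deriv f) s))
          / (LINT s=ereal v..ereal u|lebesgue. deriv (deriv f) s))"

text \<open>The restarted functional: initial time \<open>\<tau>\<close> and initial datum \<open>u(\<cdot>,\<tau>)\<close>.\<close>

definition E_restart ::
    "(real \<Rightarrow> real) \<Rightarrow> (real \<Rightarrow> real) \<Rightarrow> real \<Rightarrow> real \<Rightarrow> real \<Rightarrow> real \<Rightarrow> real" where
  "E_restart f \<phi> \<tau> v x t =
     (t - \<tau>) * (LINT s=ereal 0..ereal v|lebesgue.
        (deriv (deriv f) s * (entropy_sol f \<phi> (x - (t - \<tau>) * deriv f s) \<tau> - s)))"

definition maximizers_restart ::
    "(real \<Rightarrow> real) \<Rightarrow> (real \<Rightarrow> real) \<Rightarrow> real \<Rightarrow> real \<Rightarrow> real \<Rightarrow> real set" where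
  "maximizers_restart f \<phi> \<tau> x t =
     {u. \<forall>v. E_restart f \<phi> \<tau> v x t \<le> E_restart f \<phi> \<tau> u x t}"

definition char_values_restart :: "(real \<Rightarrow> real) \<Rightarrow> (real \<Rightarrow> real) \<Rightarrow> real \<Rightarrow> real \<Rightarrow> real set" where
  "char_values_restart f \<phi> \<tau> x =
     {c. \<exists>t>\<tau>. c \<in> maximizers_restart f \<phi> \<tau> (x + (t - \<tau>) * deriv f c) t}"

definition cont_shock_gen_point :: "(real \<Rightarrow> real) \<Rightarrow> (real \<Rightarrow> real) \<Rightarrow> real \<Rightarrow> real \<Rightarrow> bool" where
  "cont_shock_gen_point f \<phi> x t \<longleftrightarrow>
     t > 0 \<and> trace_left f \<phi> x t = trace_right f \<phi> x t \<and> char_values_restart f \<phi> t x = {}"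

text \<open>
  A continuous shock generation point of the characteristic \<open>L\<^sub>c(x0)\<close>: the characteristic must
  actually carry its value \<open>c\<close> up to the point, that is \<open>c \<in> \<U>(x,t)\<close>. This is not automatic at
  \<open>(x\<^sub>p,t\<^sub>p)\<close>: \<open>t\<^sub>p\<close> is determined by the data near \<open>x0\<close> only, so \<open>L\<^sub>c(x0)\<close> may be absorbed by a
  shock before the time \<open>t\<^sub>p\<close>, and the prolonged half-line may meet, at the time \<open>t\<^sub>p\<close>, a continuous
  shock generation point belonging to a different characteristic.
\<close>

definition cont_shock_gen_point_of_char ::
    "(real \<Rightarrow> real) \<Rightarrow> (real \<Rightarrow> real) \<Rightarrow> real \<Rightarrow> real \<Rightarrow> real \<Rightarrow> real \<Rightarrow> bool" where
  "cont_shock_gen_point_of_char f \<phi> x0 c x t \<longleftrightarrow>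
     (x, t) \<in> char_line f c x0 \<and> c \<in> maximizers f \<phi> x t \<and> cont_shock_gen_point f \<phi> x t"

text \<open>
  \<open>f''(u) = (N + o(1)) |u - c|\<^sup>\<alpha>\<close> as \<open>u\<close> tends to \<open>c\<close> from the right or from the left, depending
  on whether the filter \<open>G\<close> is \<open>at_right c\<close> or \<open>at_left c\<close>.
\<close>

definition flux_asymp :: "real filter \<Rightarrow> (real \<Rightarrow> real) \<Rightarrow> real \<Rightarrow> real \<Rightarrow> real \<Rightarrow> bool" where
  "flux_asymp G f c \<alpha> N \<longleftrightarrow>
     (\<lambda>u. deriv (deriv f) u - N * \<bar>u - c\<bar> powr \<alpha>) \<in> o[G](\<lambda>u. \<bar>u - c\<bar> powr \<alpha>)"

text \<open>
  \<open>\<phi>(x0 + l) - c = (C + o(1)) sgn(l) |l|\<^sup>\<gamma>\<close> as \<open>l\<close> tends to \<open>0\<close> along \<open>G\<close> (\<open>at_right 0\<close> or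
  \<open>at_left 0\<close>). As \<open>\<phi>\<close> stands for a class in \<open>L\<^sup>\<infinity>\<close>, the relation is required outside a null set
  of \<open>l\<close> only; this is what the filter \<open>ae_filter lebesgue\<close> expresses.
\<close>

definition data_asymp ::
    "real filter \<Rightarrow> (real \<Rightarrow> real) \<Rightarrow> real \<Rightarrow> real \<Rightarrow> real \<Rightarrow> real \<Rightarrow> bool" where
  "data_asymp G \<phi> x0 c \<gamma> C \<longleftrightarrow>
     (\<lambda>l. \<phi> (x0 + l) - c - C * sgn l * \<bar>l\<bar> powr \<gamma>)
       \<in> o[inf G (ae_filter lebesgue)](\<lambda>l. sgn l * \<bar>l\<bar> powr \<gamma>)"

end

theory Submission
  imports Defs
begin

text \<open>
  The substitution \<open>y = x - t f'(s)\<close> turns the maximisation of \<open>E\<close> into the Lax--Oleinik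
  minimisation of \<open>\<Phi>(x - t f'(u)) + t G(u)\<close> with \<open>G(u) = u f'(u) - f(u)\<close>. On a characteristic
  \<open>L\<^sub>c(x\<^sub>0)\<close>, the value \<open>c\<close> is optimal at time \<open>t\<close> iff
  \<open>\<Phi>(l;x\<^sub>0,c) \<ge> - t B(l/t)\<close> for all admissible \<open>l\<close>, where \<open>B\<close> is a Bregman distance, strictly convex in
  the speed. As \<open>t B(l/t)\<close> is strictly decreasing in \<open>t\<close>, optimality of \<open>c\<close> at \<open>t\<close> makes \<open>c\<close> the
  unique maximizer at every earlier time; conversely, if \<open>c\<close> is the unique maximizer at a time
  \<open>t < t\<^sub>p\<close>, then compactness reduces optimality at slightly later times to small \<open>l\<close>, where the
  definition of \<open>t\<^sub>p\<close> grants it. Hence \<open>c\<close> ceases to be optimal exactly at \<open>t = t\<^sub>p\<close>. The value function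
  \<open>V(\<cdot>,\<tau>)\<close> is a primitive of the entropy solution, so the restarted problem is again a Lax--Oleinik
  problem, with datum \<open>V(\<cdot>,\<tau>)\<close>, and the semigroup property identifies \<open>\<C>\<^sub>\<tau>(x) = \<emptyset>\<close> with the
  failure of \<open>c\<close> to be optimal at any later time. The formulas for \<open>t\<^sub>p\<^sup>\<plusminus>\<close> follow by comparing the
  leading powers of both sides of the local condition.
\<close>

section \<open>Integrals and primitives\<close>

lemma interval_lebesgue_integral_lebesgue_eq_lborel:
  fixes h :: "real \<Rightarrow> real"
  assumes "h \<in> borel_measurable borel"
  shows "(LINT s=a..b|lebesgue. h s) = (LBINT s=a..b. h s)"
  using assms
  by (auto simp: interval_lebesgue_integral_def set_lebesgue_integral_def intro!: integral_completion)

lemma interval_lebesgue_integral_lebesgue_FTC: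
  fixes h F :: "real \<Rightarrow> real" and a b :: real
  assumes "continuous_on UNIV h" and "\<And>s. (F has_real_derivative h s) (at s)"
  shows "(LINT s=a..b|lebesgue. h s) = F b - F a"
proof -
  have "(LINT s=a..b|lebesgue. h s) = (LBINT s=a..b. h s)"
    using assms(1) by (intro interval_lebesgue_integral_lebesgue_eq_lborel borel_measurable_continuous_onI)
  also have "\<dots> = F b - F a"
    using assms
    by (intro interval_integral_FTC_finite)
       (auto intro: continuous_on_subset has_field_derivative_at_within
             simp: has_real_derivative_iff_has_vector_derivative[symmetric])
  finally show ?thesis .
qed

text \<open>Transfers an integral for \<open>lebesgue\<close> to one for \<open>lborel\<close>
  through a Borel representative \<open>h'\<close>. The measurability of \<open>h\<close> comes for
  free, since in a complete measure a function a.e. equal to a measurable one is measurable.\<close>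

lemma interval_lebesgue_integral_lebesgue_cong_AE_lborel:
  fixes h h' :: "real \<Rightarrow> real"
  assumes h': "h' \<in> borel_measurable borel" and ae: "AE x in lborel. h x = h' x"
  shows "(LINT s=a..b|lebesgue. h s) = (LBINT s=a..b. h' s)"
proof -
  have ae': "AE x in lebesgue. h' x = h x" using AE_completion[OF ae] by (auto elim: eventually_mono)
  have m: "h' \<in> borel_measurable lebesgue"
    using h' by (simp add: measurable_completion)
  have "h \<in> borel_measurable lebesgue"
    using m ae' by (rule borel_measurable_AE)
  then have "(LINT s=a..b|lebesgue. h s) = (LINT s=a..b|lebesgue. h' s)"
    using m ae'
    unfolding interval_lebesgue_integral_def set_lebesgue_integral_def
    by (auto intro!: integral_cong_AE borel_measurable_times borel_measurable_indicator
        elim: eventually_mono)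
  with interval_lebesgue_integral_lebesgue_eq_lborel[OF h'] show ?thesis by simp
qed

lemma Linfty_fun_borel_representative:
  assumes "Linfty_fun \<phi>"
  obtains \<psi> M where "\<psi> \<in> borel_measurable borel" "\<And>x. \<bar>\<psi> x\<bar> \<le> M" "0 \<le> M" "AE x in lborel. \<phi> x = \<psi> x"
proof -
  from assms obtain M where m: "\<phi> \<in> borel_measurable lebesgue" and M: "AE x in lebesgue. \<bar>\<phi> x\<bar> \<le> M"
    by (auto simp: Linfty_fun_def)
  from completion_ex_borel_measurable_real[OF m] obtain \<psi> where
    p: "\<psi> \<in> borel_measurable borel" "AE x in lborel. \<phi> x = \<psi> x" by auto
  \<comment> \<open>Truncating the Borel version at the essential bound changes it on a null set
    only and turns the a.e. bound into a pointwise one; \<open>\<bar>M\<bar>\<close> makes the bound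
    visibly nonnegative.\<close>
  define \<eta> where "\<eta> = (\<lambda>x. max (- \<bar>M\<bar>) (min \<bar>M\<bar> (\<psi> x)))"
  have "AE x in lborel. \<bar>\<phi> x\<bar> \<le> M" using M by (simp add: AE_completion_iff)
  with p(2) have "AE x in lborel. \<phi> x = \<eta> x" by eventually_elim (auto simp: \<eta>_def)
  moreover have "\<eta> \<in> borel_measurable borel" unfolding \<eta>_def using p(1) by measurable
  moreover have "\<bar>\<eta> x\<bar> \<le> \<bar>M\<bar>" for x by (auto simp: \<eta>_def)
  ultimately show ?thesis using that[of \<eta> "\<bar>M\<bar>"] by auto
qed

lemma set_integrable_bounded_Icc:
  fixes h :: "real \<Rightarrow> real"
  assumes "h \<in> borel_measurable borel" "\<And>x. \<bar>h x\<bar> \<le> M"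
  shows "set_integrable lborel {a..b} h"
  unfolding set_integrable_def
proof (rule Bochner_Integration.integrable_bound[where f = "\<lambda>x. indicator {a..b} x * M"])
  show "integrable lborel (\<lambda>x. indicator {a..b} x * M)"
    by (intro integrable_mult_left integrable_real_indicator) (auto simp: emeasure_lborel_Icc_eq)
qed (use assms in \<open>auto simp: indicator_def intro!: always_eventually intro: order_trans[OF _ abs_ge_self]\<close>)

lemma interval_lebesgue_integrable_bounded:
  fixes h :: "real \<Rightarrow> real" and a b :: real
  assumes "h \<in> borel_measurable borel" "\<And>x. \<bar>h x\<bar> \<le> M"
  shows "interval_lebesgue_integrable lborel a b h"
  unfolding interval_lebesgue_integrable_def
  by (auto intro!: set_integrable_subset[OF set_integrable_bounded_Icc[OF assms, of "min a b" "max a b"]])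

lemma abs_interval_integral_le:
  fixes h :: "real \<Rightarrow> real" and a b :: real
  assumes h: "h \<in> borel_measurable borel" and M: "\<And>x. \<bar>h x\<bar> \<le> M"
  shows "\<bar>LBINT x=a..b. h x\<bar> \<le> M * \<bar>b - a\<bar>"
proof -
  have *: "\<bar>LBINT x=a..b. h x\<bar> \<le> M * (b - a)" if "a \<le> b" for a b :: real
  proof -
    have "\<bar>LBINT x=a..b. h x\<bar> = norm (LBINT x:{a..b}. h x)"
      using that by (simp add: interval_integral_Icc)
    also have "\<dots> \<le> (LBINT x:{a..b}. norm (h x))"
      by (rule set_integral_norm_bound[OF set_integrable_bounded_Icc[OF h M]])
    also have "\<dots> \<le> (LBINT x:{a..b}. M)"
    proof (rule set_integral_mono)
      show "set_integrable lborel {a..b} (\<lambda>x. norm (h x))"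
        using h M by (intro set_integrable_bounded_Icc[where M = M]) auto
      show "set_integrable lborel {a..b} (\<lambda>x. M)"
        by (intro set_integrable_bounded_Icc[where M = "\<bar>M\<bar>"]) auto
    qed (use M in auto)
    also have "\<dots> = M * (b - a)"
      using that by (simp add: set_lebesgue_integral_def)
    finally show ?thesis .
  qed
  show ?thesis
  proof (cases "a \<le> b")
    case True then show ?thesis using *[of a b] by simp
  next
    case False then show ?thesis using *[of b a] by (subst interval_integral_endpoints_reverse) simp
  qed
qed

lemma Phi_diff_AE:
  assumes "\<psi> \<in> borel_measurable borel" "\<And>x. \<bar>\<psi> x\<bar> \<le> M" "AE x in lborel. \<phi> x = \<psi> x"
  shows "Phi \<phi> b - Phi \<phi> a = (LBINT x=a..b. \<psi> x)"
proof -
  have P: "Phi \<phi> x = (LBINT x=0..x. \<psi> x)" for x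
    unfolding Phi_def by (subst interval_lebesgue_integral_lebesgue_cong_AE_lborel[OF assms(1,3)]) (simp add: zero_ereal_def)
  have "interval_lebesgue_integrable lborel (min 0 (min (ereal a) b)) (max 0 (max (ereal a) b)) \<psi>"
    using interval_lebesgue_integrable_bounded[OF assms(1,2), of "min 0 (min a b)" "max 0 (max a b)"]
    by (simp add: zero_ereal_def ereal_min ereal_max)
  then have "(LBINT x=0..a. \<psi> x) + (LBINT x=a..b. \<psi> x) = (LBINT x=0..b. \<psi> x)"
    by (rule interval_integral_sum)
  with P show ?thesis by simp
qed

lemma Phi_lipschitz:
  assumes "Linfty_fun \<phi>"
  obtains M where "0 \<le> M" "\<And>x y. \<bar>Phi \<phi> x - Phi \<phi> y\<bar> \<le> M * \<bar>x - y\<bar>"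
proof -
  obtain \<psi> M where p: "\<psi> \<in> borel_measurable borel" "\<And>x. \<bar>\<psi> x\<bar> \<le> M" "0 \<le> M" "AE x in lborel. \<phi> x = \<psi> x"
    using Linfty_fun_borel_representative[OF assms] by metis
  show ?thesis
    using that[OF p(3)] abs_interval_integral_le[OF p(1,2)] Phi_diff_AE[OF p(1,2,4)] by metis
qed

lemma Phi_loc_eq:
  assumes "Linfty_fun \<phi>"
  shows "Phi_loc \<phi> l x0 c = Phi \<phi> (x0 + l) - Phi \<phi> x0 - c * l"
proof -
  obtain \<psi> M where p: "\<psi> \<in> borel_measurable borel" "\<And>x. \<bar>\<psi> x\<bar> \<le> M" "0 \<le> M" "AE x in lborel. \<phi> x = \<psi> x"
    using Linfty_fun_borel_representative[OF assms] by metis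
  have "Phi_loc \<phi> l x0 c = (LBINT x=x0..x0+l. \<psi> x - c)"
    unfolding Phi_loc_def
    using p by (intro interval_lebesgue_integral_lebesgue_cong_AE_lborel) (auto elim: eventually_mono)
  also have "\<dots> = (LBINT x=x0..x0+l. \<psi> x) - (LBINT x=x0..x0+l. c)"
    by (intro interval_lebesgue_integral_diff interval_lebesgue_integrable_bounded[OF p(1,2)]
          interval_lebesgue_integrable_bounded[where M = "\<bar>c\<bar>"]) auto
  also have "(LBINT x=x0..x0+l. c) = c * l" by simp
  finally show ?thesis using Phi_diff_AE[OF p(1,2,4)] by simp
qed

section \<open>Convex fluxes\<close>

locale convex_flux =
  fixes f :: "real \<Rightarrow> real"
  assumes C2: "C2_fun f"
    and convex: "deriv (deriv f) u \<ge> 0"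
    and null: "emeasure lebesgue {u. deriv (deriv f) u = 0} = 0"
begin

abbreviation g :: "real \<Rightarrow> real" where "g \<equiv> deriv f"
abbreviation k :: "real \<Rightarrow> real" where "k \<equiv> deriv (deriv f)"

text \<open>\<open>G\<close> is the Legendre transform of \<open>f\<close> composed with \<open>f'\<close>, and \<open>breg\<close> the associated Bregman
  distance.\<close>

definition G :: "real \<Rightarrow> real" where "G u = u * g u - f u"

definition breg :: "real \<Rightarrow> real \<Rightarrow> real" where "breg u v = G u - G v - v * (g u - g v)"

lemma f_deriv: "(f has_real_derivative g x) (at x)"
  using C2 by (auto simp: C2_fun_def DERIV_deriv_iff_real_differentiable)

lemma g_deriv: "(g has_real_derivative k x) (at x)"
  using C2 by (auto simp: C2_fun_def DERIV_deriv_iff_real_differentiable)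

lemma G_deriv: "(G has_real_derivative x * k x) (at x)"
  unfolding G_def[abs_def] by (auto intro!: derivative_eq_intros f_deriv g_deriv)

lemma k_cont: "continuous_on A k"
  using C2 by (auto simp: C2_fun_def intro: continuous_on_subset)

lemma g_cont: "continuous_on A g"
  by (rule DERIV_continuous_on) (rule has_field_derivative_at_within[OF g_deriv])

lemma G_cont: "continuous_on A G"
  by (rule DERIV_continuous_on) (rule has_field_derivative_at_within[OF G_deriv])

lemma g_mono: "u \<le> v \<Longrightarrow> g u \<le> g v"
  by (rule DERIV_nonneg_imp_nondecreasing) (use g_deriv convex in blast)+

text \<open>If \<open>g\<close> took equal values at \<open>u < v\<close>, monotonicity would make
  it constant in between, so \<open>k\<close> would vanish on an open interval, which has positive
  measure, against \<open>null\<close>.\<close>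

lemma g_less: assumes "u < v" shows "g u < g v"
proof (rule ccontr)
  assume "\<not> g u < g v"
  then have eq: "g x = g u" if "u \<le> x" "x \<le> v" for x
    using g_mono[of u x] g_mono[of x v] that by simp
  have "k x = 0" if "u < x" "x < v" for x
  proof -
    have "eventually (\<lambda>y. y \<in> {u<..<v}) (nhds x)"
      using that by (intro eventually_nhds_in_open) auto
    then have "eventually (\<lambda>y. g y = g u) (nhds x)"
      by eventually_elim (auto intro: eq)
    then have "(g has_real_derivative 0) (at x)"
      using DERIV_cong_ev[OF refl _ refl, of g "\<lambda>_. g u" x 0] by simp
    then show ?thesis using g_deriv DERIV_unique by blast
  qed
  then have sub: "{u<..<v} \<subseteq> {u. k u = 0}" by auto
  have "{u. k u = 0} = k -` {0} \<inter> space borel" by auto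
  also have m: "\<dots> \<in> sets borel"
    by (rule measurable_sets[OF borel_measurable_continuous_onI[OF k_cont]]) auto
  finally have "emeasure lborel {u<..<v} \<le> emeasure lborel {u. k u = 0}"
    by (intro emeasure_mono sub) auto
  with null assms show False
    using m by (simp add: vimage_def ennreal_eq_0_iff)
qed

lemma g_less_iff: "g u < g v \<longleftrightarrow> u < v"
  using g_less g_mono by (meson leD leI)

lemma g_le_iff: "g u \<le> g v \<longleftrightarrow> u \<le> v"
  using g_less_iff by (meson linorder_not_le)

lemma g_eq_iff: "g u = g v \<longleftrightarrow> u = v"
  using g_le_iff by (metis order_antisym order_refl)

lemma inv_g: "inv g (g u) = u"
  by (rule inv_f_f) (auto simp: inj_def g_eq_iff)

lemma g_IVT: assumes "g u \<le> y" "y \<le> g v" obtains w where "u \<le> w" "w \<le> v" "g w = y"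
proof -
  have "u \<le> v" using assms g_le_iff by (meson order_trans)
  with IVT'[of g u y v] assms g_cont that show ?thesis by auto
qed

lemma inv_g_cont: "isCont (inv g) (g c)"
proof -
  have "isCont (inv g) y" if "y = g c" for y
    unfolding that
    by (rule isCont_inverse_function[where d = 1])
       (auto simp: inv_g intro: continuous_on_interior[OF g_cont[of UNIV]])
  then show ?thesis by simp
qed

text \<open>The range of \<open>g\<close> may be a proper subset of the line, but it contains a
  neighbourhood of each of its values; there \<open>inv g\<close> is a genuine inverse.\<close>

lemma eventually_in_range_g: "\<forall>\<^sub>F y in nhds (g c). \<exists>u. g u = y"
proof -
  have "\<forall>\<^sub>F y in nhds (g c). y \<in> {g (c - 1)<..<g (c + 1)}"
    by (intro eventually_nhds_in_open) (auto simp: g_less_iff)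
  then show ?thesis
    by eventually_elim (metis g_IVT greaterThanLessThan_iff less_imp_le)
qed

text \<open>After cancellation, \<open>breg u v\<close> is the gap at \<open>v\<close> between
  \<open>f\<close> and its tangent at \<open>u\<close>. The mean value theorem and the strict
  monotonicity of \<open>g\<close> make it positive.\<close>

lemma breg_pos: assumes "u \<noteq> v" shows "breg u v > 0"
proof -
  have eq: "breg u v = (u - v) * g u - (f u - f v)"
    by (simp add: breg_def G_def algebra_simps)
  show ?thesis
  proof (cases "v < u")
    case True
    obtain z where z: "v < z" "z < u" "f u - f v = (u - v) * g z"
      using MVT2[OF True f_deriv] by auto
    then have "(u - v) * g z < (u - v) * g u" by (intro mult_strict_left_mono) (auto simp: g_less_iff)
    with eq z show ?thesis by simp
  next
    case False
    then have "u < v" using assms by simp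
    then obtain z where z: "u < z" "z < v" "f v - f u = (v - u) * g z"
      using MVT2[OF _ f_deriv] by blast
    then have "(v - u) * g u < (v - u) * g z" by (intro mult_strict_left_mono) (auto simp: g_less_iff)
    with eq z show ?thesis by (simp add: algebra_simps)
  qed
qed

lemma breg_same [simp]: "breg u u = 0" by (simp add: breg_def)

lemma breg_nonneg: "breg u v \<ge> 0" using breg_pos[of u v] by (cases "u = v") auto

lemma G_diff: "G u - G v = v * (g u - g v) + breg u v" by (simp add: breg_def)

lemma breg_deriv: "((\<lambda>u. breg u c) has_real_derivative (u - c) * k u) (at u)"
  unfolding breg_def by (auto intro!: derivative_eq_intros G_deriv g_deriv simp: algebra_simps)

section \<open>The integrals \<open>F_loc\<close> and \<open>rho\<close> in terms of speeds and
  Bregman distances\<close>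

lemma integral_k: "(LINT s=ereal v..ereal u|lebesgue. k s) = g u - g v"
  by (rule interval_lebesgue_integral_lebesgue_FTC[OF k_cont g_deriv])

lemma integral_sk: "(LINT s=ereal v..ereal u|lebesgue. (s * k s)) = G u - G v"
  by (rule interval_lebesgue_integral_lebesgue_FTC[OF _ G_deriv]) (intro continuous_intros k_cont)

lemma F_loc_eq: "F_loc f l t c = - t * breg (u_loc f l t c) c"
proof -
  have "(LINT s=ereal c..ereal u|lebesgue. ((s - c) * k s)) = breg u c - breg c c" for u
    by (rule interval_lebesgue_integral_lebesgue_FTC[OF _ breg_deriv]) (intro continuous_intros k_cont)
  then show ?thesis by (simp add: F_loc_def)
qed

text \<open>Here \<open>rho f u c\<close> is the quotient of the increments of \<open>G\<close> and
  of \<open>g\<close>, so the product with the displacement collapses to the Bregman cost. This is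
  how the criterion with \<open>rho\<close> becomes a statement about optimality.\<close>

lemma rho_eq: "(rho f u c - c) * (t * (g c - g u)) = - t * breg u c"
proof (cases "u = c")
  case False
  then have "g u - g c \<noteq> 0" by (simp add: g_eq_iff)
  then show ?thesis using False
    unfolding rho_def integral_k integral_sk breg_def by (simp add: field_simps)
qed simp

text \<open>By substitution, the integral of \<open>t * k\<close> over the preimage of
  \<open>N\<close> is at most the measure of \<open>N\<close>, hence zero. So changing \<phi> on a
  null set leaves the product of \<open>k\<close> and \<phi> at the foot point unchanged almost
  everywhere.\<close>

lemma AE_pullback_null:
  assumes N: "N \<in> null_sets lborel" and t: "t > 0"
  shows "AE s in lborel. x - t * g s \<in> N \<longrightarrow> k s = 0"
proof -
  have Nb [measurable]: "N \<in> sets borel" using N by auto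
  have "AE s in lborel. s \<in> {- real n..real n} \<longrightarrow> x - t * g s \<in> N \<longrightarrow> k s = 0" for n
  proof -
    \<comment> \<open>The substitution rule wants an increasing map, so the negative of the foot
      point is used and \<open>N\<close> is reflected accordingly.\<close>
    let ?h = "\<lambda>s. t * g s - x" and ?c = "\<lambda>y. indicator N (- y) :: real"
    have [measurable]: "k \<in> borel_measurable borel" "g \<in> borel_measurable borel"
      by (intro borel_measurable_continuous_onI k_cont g_cont)+
    have "(\<integral>\<^sup>+s. ?c (?h s) * (t * k s) * indicator {- real n..real n} s \<partial>lborel)
        = (\<integral>\<^sup>+y. ?c y * indicator {?h (- real n)..?h (real n)} y \<partial>lborel)"
      using t convex
      by (intro nn_integral_substitution[symmetric])
         (auto intro!: derivative_eq_intros g_deriv continuous_intros k_cont simp: set_borel_measurable_def)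
    also have "\<dots> \<le> (\<integral>\<^sup>+y. indicator N (- y) \<partial>lborel)"
      by (intro nn_integral_mono) (auto simp: indicator_def)
    also have "\<dots> = (\<integral>\<^sup>+y. indicator N y \<partial>lborel)"
      using nn_integral_real_affine[of "indicator N" "-1" 0] by simp
    also have "\<dots> = 0" using null_setsD1[OF N] by simp
    finally have "(\<integral>\<^sup>+s. ?c (?h s) * (t * k s) * indicator {- real n..real n} s \<partial>lborel) = 0" by simp
    then have "AE s in lborel. ennreal (?c (?h s) * (t * k s) * indicator {- real n..real n} s) = 0"
      by (subst (asm) nn_integral_0_iff_AE) auto
    then show ?thesis
    proof eventually_elim
      case (elim s)
      then show ?case using t convex[of s]
        by (auto simp: ennreal_eq_0_iff indicator_def mult_le_0_iff split: if_splits)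
    qed
  qed
  then have "AE s in lborel. \<forall>n. s \<in> {- real n..real n} \<longrightarrow> x - t * g s \<in> N \<longrightarrow> k s = 0"
    by (subst AE_all_countable) blast
  then show ?thesis
  proof eventually_elim
    case (elim s)
    obtain n where "\<bar>s\<bar> \<le> real n" using real_arch_simple by blast
    then have "s \<in> {- real n..real n}" by auto
    with elim show ?case by blast
  qed
qed

text \<open>The change of variables \<open>y = x - t f'(s)\<close>.\<close>

lemma integral_along_characteristics:
  assumes phi: "Linfty_fun \<phi>" and t: "t > 0" and ab: "a \<le> b"
  shows "t * (LINT s=ereal a..ereal b|lebesgue. (k s * (\<phi> (x - t * g s) - s)))
    = Phi \<phi> (x - t * g a) - Phi \<phi> (x - t * g b) - t * (G b - G a)"
proof -
  obtain \<psi> M where p: "\<psi> \<in> borel_measurable borel" "\<And>x. \<bar>\<psi> x\<bar> \<le> M" "0 \<le> M" "AE x in lborel. \<phi> x = \<psi> x"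
    using Linfty_fun_borel_representative[OF phi] by metis
  note [measurable] = p(1)
  have [measurable]: "k \<in> borel_measurable borel" "g \<in> borel_measurable borel"
    by (intro borel_measurable_continuous_onI k_cont g_cont)+
  let ?h = "\<lambda>s. t * g s - x"
  obtain N where N: "N \<in> null_sets lborel" "{y. \<phi> y \<noteq> \<psi> y} \<subseteq> N"
    using p(4) by (auto simp: eventually_ae_filter)
  \<comment> \<open>Where \<open>k s = 0\<close> both sides vanish; elsewhere the foot point avoids
    \<open>N\<close>, so \<phi> and \<psi> agree there.\<close>
  have "AE s in lborel. k s * (\<phi> (x - t * g s) - s) = k s * \<psi> (x - t * g s) - k s * s"
    using AE_pullback_null[OF N(1) t, of x]
  proof eventually_elim
    case (elim s)
    then show ?case using N(2) by (cases "k s = 0") (auto simp: algebra_simps)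
  qed
  then have 1: "(LINT s=ereal a..ereal b|lebesgue. (k s * (\<phi> (x - t * g s) - s)))
     = (LBINT s=a..b. k s * \<psi> (x - t * g s) - k s * s)"
    by (intro interval_lebesgue_integral_lebesgue_cong_AE_lborel) auto
  have hd: "(?h has_real_derivative t * k s) (at s)" for s
    by (auto intro!: derivative_eq_intros g_deriv)
  have si: "set_integrable lborel {?h a..?h b} (\<lambda>y. \<psi> (- y))"
    using p by (intro set_integrable_bounded_Icc[where M = M]) auto
  have S: "set_integrable lborel {a..b} (\<lambda>s. \<psi> (- ?h s) * (t * k s))"
    "(LBINT y=?h a..?h b. \<psi> (- y)) = (LBINT s=a..b. \<psi> (- ?h s) * (t * k s))"
    using t convex
    by (intro interval_integral_substitution[OF si hd _ _ ab] continuous_intros k_cont; simp)+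
  have S1: "interval_lebesgue_integrable lborel a b (\<lambda>s. k s * \<psi> (x - t * g s))"
  proof -
    have "set_integrable lborel {a..b} (\<lambda>s. (1 / t) * (\<psi> (- ?h s) * (t * k s)))"
      using S(1) by (rule set_integrable_mult_right)
    also have "(\<lambda>s. (1 / t) * (\<psi> (- ?h s) * (t * k s))) = (\<lambda>s. k s * \<psi> (x - t * g s))"
      using t by (auto simp: fun_eq_iff)
    finally show ?thesis
      using ab by (auto simp: interval_lebesgue_integrable_def intro: set_integrable_subset)
  qed
  have S2: "interval_lebesgue_integrable lborel a b (\<lambda>s. k s * s)"
    using ab by (intro interval_integrable_continuous_on continuous_intros k_cont)
  have "t * (LBINT s=a..b. k s * \<psi> (x - t * g s)) = (LBINT s=a..b. \<psi> (- ?h s) * (t * k s))"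
    by (subst interval_lebesgue_integral_mult_right[symmetric]) (auto simp: algebra_simps)
  also have "\<dots> = (LBINT y=?h a..?h b. \<psi> (- y))" using S(2) by simp
  also have "\<dots> = (LBINT y=x - t * g b..x - t * g a. \<psi> y)"
    by (subst interval_integral_reflect) simp
  also have "\<dots> = Phi \<phi> (x - t * g a) - Phi \<phi> (x - t * g b)"
    by (rule Phi_diff_AE[OF p(1,2,4), symmetric])
  finally have 2: "t * (LBINT s=a..b. k s * \<psi> (x - t * g s)) = Phi \<phi> (x - t * g a) - Phi \<phi> (x - t * g b)" .
  have 3: "(LBINT s=a..b. k s * s) = G b - G a"
    by (subst interval_lebesgue_integral_lebesgue_eq_lborel[symmetric])
       (auto simp: mult.commute integral_sk)
  show ?thesis
    unfolding 1 by (subst interval_lebesgue_integral_diff(2)[OF S1 S2]) (simp add: right_diff_distrib 2 3)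
qed

lemma E_fun_eq:
  assumes phi: "Linfty_fun \<phi>" and t: "t > 0"
  shows "E_fun f \<phi> u x t = Phi \<phi> (x - t * g 0) - Phi \<phi> (x - t * g u) - t * (G u - G 0)"
proof (cases "0 \<le> u")
  case True
  then show ?thesis unfolding E_fun_def by (rule integral_along_characteristics[OF phi t])
next
  case False
  then have "E_fun f \<phi> u x t = - (t * (LINT s=ereal u..ereal 0|lebesgue. (k s * (\<phi> (x - t * g s) - s))))"
    unfolding E_fun_def by (simp add: interval_lebesgue_integral_def)
  also have "\<dots> = - (Phi \<phi> (x - t * g u) - Phi \<phi> (x - t * g 0) - t * (G 0 - G u))"
    using False by (subst integral_along_characteristics[OF phi t]) auto
  finally show ?thesis by (simp add: algebra_simps)
qed

text \<open>Up to sign and an additive constant, \<open>lax\<close> is the functional \<open>E\<close>: maximising \<open>E\<close> is the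
  Lax--Oleinik minimisation over the foot points \<open>x - t f'(u)\<close>.\<close>

definition lax :: "(real \<Rightarrow> real) \<Rightarrow> real \<Rightarrow> real \<Rightarrow> real \<Rightarrow> real" where
  "lax \<phi> u x t = Phi \<phi> (x - t * g u) + t * G u"

lemma maximizers_iff:
  assumes "Linfty_fun \<phi>" "t > 0"
  shows "u \<in> maximizers f \<phi> x t \<longleftrightarrow> (\<forall>v. lax \<phi> u x t \<le> lax \<phi> v x t)"
  unfolding maximizers_def lax_def by (simp add: E_fun_eq[OF assms] algebra_simps)

end

section \<open>The set of maximizers\<close>

locale convex_flux_data = convex_flux f for f +
  fixes \<phi> :: "real \<Rightarrow> real"
  assumes Linfty: "Linfty_fun \<phi>"
begin

abbreviation U :: "real \<Rightarrow> real \<Rightarrow> real set" where "U \<equiv> maximizers f \<phi>"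
abbreviation H :: "real \<Rightarrow> real \<Rightarrow> real \<Rightarrow> real" where "H \<equiv> lax \<phi>"

lemmas U_iff = maximizers_iff[OF Linfty]

lemma Phi_isCont: "isCont (Phi \<phi>) x"
proof -
  obtain M where M: "0 \<le> M" "\<And>x y. \<bar>Phi \<phi> x - Phi \<phi> y\<bar> \<le> M * \<bar>x - y\<bar>"
    using Phi_lipschitz[OF Linfty] by metis
  have "M-lipschitz_on UNIV (Phi \<phi>)"
    using M by (intro lipschitz_onI) (auto simp: dist_real_def)
  then have "continuous_on UNIV (Phi \<phi>)" by (rule lipschitz_on_continuous_on)
  then show ?thesis by (simp add: continuous_on_eq_continuous_at)
qed

lemma G_isCont: "isCont G u" and g_isCont: "isCont g u"
  using G_cont[of UNIV] g_cont[of UNIV] by (auto simp: continuous_on_eq_continuous_at)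

lemma H_tendsto:
  assumes "(u \<longlongrightarrow> u0) F" "(x \<longlongrightarrow> x0) F" "(t \<longlongrightarrow> t0) F"
  shows "((\<lambda>n. H (u n) (x n) (t n)) \<longlongrightarrow> H u0 x0 t0) F"
  unfolding lax_def
  by (intro tendsto_intros assms isCont_tendsto_compose[OF Phi_isCont]
        isCont_tendsto_compose[OF G_isCont] isCont_tendsto_compose[OF g_isCont])

lemma H_cont: "continuous_on A (\<lambda>u. H u x t)"
  unfolding continuous_on_def by (auto intro!: H_tendsto tendsto_ident_at)

text \<open>With \<open>M\<close> a Lipschitz constant of \<open>Phi \<phi>\<close>, cut
  \<open>u\<close> off to \<open>sgn u * M\<close>. Moving the foot point costs at most
  \<open>M\<close> times the displacement, while \<open>t * G\<close> drops by exactly that amount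
  plus a positive Bregman term. The bound depends on neither \<open>x\<close> nor
  \<open>t\<close>.\<close>

lemma H_coercive:
  obtains M where "0 \<le> M" "\<And>u x t. t > 0 \<Longrightarrow> M < \<bar>u\<bar> \<Longrightarrow> \<exists>v. \<bar>v\<bar> \<le> M \<and> H v x t < H u x t"
proof -
  obtain M where M: "0 \<le> M" "\<And>x y. \<bar>Phi \<phi> x - Phi \<phi> y\<bar> \<le> M * \<bar>x - y\<bar>"
    using Phi_lipschitz[OF Linfty] by metis
  have "\<exists>v. \<bar>v\<bar> \<le> M \<and> H v x t < H u x t" if t: "t > 0" and u: "M < \<bar>u\<bar>" for u x t
  proof -
    define v where "v = sgn u * M"
    have v: "\<bar>v\<bar> = M" "u \<noteq> v" using u M(1) by (auto simp: v_def sgn_if abs_if split: if_splits)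
    \<comment> \<open>The cut-off keeps the sign of \<open>u\<close> and lies on the same side of it
      as zero, so \<open>v\<close> and \<open>g u - g v\<close> have matching signs.\<close>
    have gg: "v * (g u - g v) = M * \<bar>g u - g v\<bar>"
      using u M(1) g_le_iff[of u v] g_le_iff[of v u]
      by (auto simp: v_def sgn_if abs_if mult_le_0_iff algebra_simps split: if_splits)
    have "Phi \<phi> (x - t * g v) - Phi \<phi> (x - t * g u) \<le> M * \<bar>t * (g u - g v)\<bar>"
      using M(2)[of "x - t * g v" "x - t * g u"] by (simp add: algebra_simps)
    also have "\<dots> = t * (v * (g u - g v))" using t by (simp add: abs_mult gg)
    also have "\<dots> < t * (v * (g u - g v)) + t * breg u v" using t breg_pos[OF v(2)] by simp
    also have "\<dots> = t * (G u - G v)" by (simp add: G_diff algebra_simps)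
    finally have "H v x t < H u x t" by (simp add: lax_def algebra_simps)
    with v show ?thesis by auto
  qed
  with M that show ?thesis by blast
qed

lemma U_bounded:
  obtains M where "0 \<le> M" "\<And>x t. t > 0 \<Longrightarrow> U x t \<subseteq> {-M..M}"
proof -
  obtain M where M: "0 \<le> M" "\<And>u x t. t > 0 \<Longrightarrow> M < \<bar>u\<bar> \<Longrightarrow> \<exists>v. \<bar>v\<bar> \<le> M \<and> H v x t < H u x t"
    using H_coercive by metis
  have "U x t \<subseteq> {-M..M}" if "t > 0" for x t
  proof
    fix u assume "u \<in> U x t"
    with that have "\<And>v. H u x t \<le> H v x t" by (simp add: U_iff)
    with M(2)[OF that, of u x] have "\<bar>u\<bar> \<le> M" by (meson linorder_not_le)
    then show "u \<in> {-M..M}" by auto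
  qed
  with M(1) that show ?thesis by blast
qed

lemma U_nonempty: assumes t: "t > 0" shows "U x t \<noteq> {}"
proof -
  obtain M where M: "0 \<le> M" "\<And>u x t. t > 0 \<Longrightarrow> M < \<bar>u\<bar> \<Longrightarrow> \<exists>v. \<bar>v\<bar> \<le> M \<and> H v x t < H u x t"
    using H_coercive by metis
  have "\<exists>u\<in>{-M..M}. \<forall>v\<in>{-M..M}. H u x t \<le> H v x t"
    using M(1) by (intro continuous_attains_inf H_cont) auto
  then obtain u where u: "\<And>v. v \<in> {-M..M} \<Longrightarrow> H u x t \<le> H v x t" by blast
  have "H u x t \<le> H v x t" for v
  proof (cases "\<bar>v\<bar> \<le> M")
    case True then show ?thesis using u[of v] by (simp add: abs_le_iff)
  next
    case False
    then obtain w where "\<bar>w\<bar> \<le> M" "H w x t < H v x t" using M(2)[OF t, of v x] by auto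
    then show ?thesis using u[of w] by (simp add: abs_le_iff)
  qed
  with t have "u \<in> U x t" by (simp add: U_iff)
  then show ?thesis by blast
qed

text \<open>The maximizer sets have a closed graph in position and time jointly: the minimality
  inequalities pass to the limit by continuity of \<open>H\<close>.\<close>

lemma U_limit:
  assumes "\<And>n. u n \<in> U (x n) (t n)" "\<And>n. t n > 0" "u \<longlonglongrightarrow> u0" "x \<longlonglongrightarrow> x0" "t \<longlonglongrightarrow> t0" "t0 > 0"
  shows "u0 \<in> U x0 t0"
proof -
  have "H u0 x0 t0 \<le> H v x0 t0" for v
  proof (rule LIMSEQ_le)
    show "(\<lambda>n. H (u n) (x n) (t n)) \<longlonglongrightarrow> H u0 x0 t0" "(\<lambda>n. H v (x n) (t n)) \<longlonglongrightarrow> H v x0 t0"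
      by (intro H_tendsto assms tendsto_const)+
    show "\<exists>N. \<forall>n\<ge>N. H (u n) (x n) (t n) \<le> H v (x n) (t n)"
      using assms(1,2) by (auto simp: U_iff)
  qed
  with assms(6) show ?thesis by (simp add: U_iff)
qed

lemma U_closed: assumes t: "t > 0" shows "closed (U x t)"
  unfolding closed_sequential_limits
  using U_limit[of _ "\<lambda>_. x" "\<lambda>_. t" _ x t] t by auto

lemma U_compact: assumes t: "t > 0" shows "compact (U x t)"
proof -
  obtain M where "U x t \<subseteq> {-M..M}" using U_bounded t by metis
  then have "bounded (U x t)" using bounded_closed_interval bounded_subset by blast
  with U_closed[OF t] show ?thesis by (simp add: compact_eq_bounded_closed)
qed

lemma Inf_in_U: "t > 0 \<Longrightarrow> Inf (U x t) \<in> U x t"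
  using U_compact[of t x] U_nonempty[of t x]
  by (intro closed_contains_Inf U_closed) (auto intro: bounded_imp_bdd_below compact_imp_bounded)

lemma Sup_in_U: "t > 0 \<Longrightarrow> Sup (U x t) \<in> U x t"
  using U_compact[of t x] U_nonempty[of t x]
  by (intro closed_contains_Sup U_closed) (auto intro: bounded_imp_bdd_above compact_imp_bounded)

lemma traces_eq_iff:
  assumes t: "t > 0"
  shows "trace_left f \<phi> x t = trace_right f \<phi> x t \<longleftrightarrow> (\<exists>c. U x t = {c})"
proof
  assume eq: "trace_left f \<phi> x t = trace_right f \<phi> x t"
  have bd: "bdd_below (U x t)" "bdd_above (U x t)"
    using compact_imp_bounded[OF U_compact[OF t, of x]]
    by (simp_all add: bounded_imp_bdd_below bounded_imp_bdd_above)
  have "u = Inf (U x t)" if "u \<in> U x t" for u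
    using cInf_lower[OF that bd(1)] cSup_upper[OF that bd(2)] eq
    by (simp add: trace_left_def trace_right_def)
  with Inf_in_U[OF t, of x] show "\<exists>c. U x t = {c}" by blast
qed (auto simp: trace_left_def trace_right_def)

text \<open>Maximizers are uniformly bounded, and by the closed graph every limit point of the
  sequence is a maximizer at the limit position and time, hence equals \<open>c\<close>.\<close>

lemma U_tendsto:
  assumes "U x0 t0 = {c}" "t0 > 0"
    and "\<And>n. u n \<in> U (x n) (t n)" "\<And>n. t n > 0" "x \<longlonglongrightarrow> x0" "t \<longlonglongrightarrow> t0"
  shows "u \<longlonglongrightarrow> c"
proof -
  obtain M where M: "\<And>x t. t > 0 \<Longrightarrow> U x t \<subseteq> {-M..M}" using U_bounded by metis
  then have uM: "u n \<in> {-M..M}" for n using assms(3,4) by blast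
  show ?thesis
  proof (rule ccontr)
    assume "\<not> u \<longlonglongrightarrow> c"
    then obtain e where e: "e > 0" "\<And>N. \<exists>n\<ge>N. e \<le> dist (u n) c"
      unfolding lim_sequentially by (meson linorder_not_le)
    have "infinite {n. e \<le> dist (u n) c}"
      using e(2) by (auto simp: infinite_nat_iff_unbounded_le)
    then obtain r :: "nat \<Rightarrow> nat" where r: "strict_mono r" "\<And>n. e \<le> dist (u (r n)) c"
      using infinite_enumerate[of "{n. e \<le> dist (u n) c}"] by auto
    have "\<And>n. (u \<circ> r) n \<in> {-M..M}" using uM by simp
    then obtain l s where s: "strict_mono (s :: nat \<Rightarrow> nat)" "((u \<circ> r) \<circ> s) \<longlonglongrightarrow> l"
      using compact_Icc[of "-M" M] unfolding compact_def by blast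
    have rs: "strict_mono (r \<circ> s)" using r(1) s(1) by (rule strict_mono_o)
    have "l \<in> U x0 t0"
      using assms s LIMSEQ_subseq_LIMSEQ[OF assms(5) rs] LIMSEQ_subseq_LIMSEQ[OF assms(6) rs]
      by (intro U_limit[of "u \<circ> r \<circ> s" "x \<circ> (r \<circ> s)" "t \<circ> (r \<circ> s)" l]) (auto simp: o_def)
    then have "l = c" using assms(1) by simp
    have "(\<lambda>n. dist ((u \<circ> r \<circ> s) n) c) \<longlonglongrightarrow> dist l c"
      by (intro tendsto_intros s)
    then have "e \<le> dist l c"
      by (rule LIMSEQ_le_const) (use r(2) in auto)
    with \<open>l = c\<close> e(1) show False by simp
  qed
qed

end

text \<open>The difference quotients \<open>D n\<close> of \<open>V\<close> are bounded by
  \<open>L\<close> and converge a.e. to \<open>w\<close>, so dominated convergence applies. Their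
  integrals are differences of difference quotients of a primitive \<open>W\<close> of
  \<open>V\<close>, and these converge to \<open>V b - V a\<close>.\<close>

lemma interval_integral_lipschitz_FTC:
  fixes V w :: "real \<Rightarrow> real" and a b :: real
  assumes L: "\<And>x y. \<bar>V x - V y\<bar> \<le> L * \<bar>x - y\<bar>"
    and w: "w \<in> borel_measurable borel"
    and ae: "AE x in lborel. (V has_real_derivative w x) (at x)"
  shows "(LBINT x=a..b. w x) = V b - V a"
proof -
  have "0 \<le> L" using L[of 0 1] by auto
  have Vc: "continuous_on A V" for A
  proof -
    have "L-lipschitz_on A V" using L \<open>0 \<le> L\<close> by (intro lipschitz_onI) (auto simp: dist_real_def)
    then show ?thesis by (rule lipschitz_on_continuous_on)
  qed
  have Vm: "V \<in> borel_measurable borel" by (rule borel_measurable_continuous_onI[OF Vc])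
  define W where "W = (\<lambda>x::real. LBINT y=0..x. V y)"
  have W: "(W has_real_derivative V x) (at x)" for x
  proof -
    have "((\<lambda>u. LBINT y=ereal 0..ereal u. V y) has_vector_derivative V x) (at x within {-\<bar>x\<bar>-1..\<bar>x\<bar>+1})"
      by (rule interval_integral_FTC2) (auto intro: Vc)
    moreover have "at x within {-\<bar>x\<bar>-1..\<bar>x\<bar>+1} = at x" by (intro at_within_Icc_at) auto
    ultimately show ?thesis
      by (simp add: W_def has_real_derivative_iff_has_vector_derivative zero_ereal_def)
  qed
  define h where "h = (\<lambda>n. 1 / real (Suc n))"
  have h: "h n > 0" for n by (simp add: h_def)
  have hlim: "filterlim h (at 0) sequentially"
    using lim_1_over_n[where 'a = real] unfolding h_def filterlim_at
    by (auto intro: LIMSEQ_inverse_real_of_nat simp: field_simps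
        intro!: LIMSEQ_Suc[where f = "\<lambda>n. 1 / real n", simplified])
  define D where "D = (\<lambda>n x. (V (x + h n) - V x) / h n)"
  have *: "(LBINT x=a..b. w x) = V b - V a" if ab: "a \<le> b" for a b :: real
  proof -
    have "(\<lambda>n. \<integral>x. indicator {a..b} x * D n x \<partial>lborel) \<longlonglongrightarrow> (\<integral>x. indicator {a..b} x * w x \<partial>lborel)"
    proof (rule integral_dominated_convergence[where w = "\<lambda>x. indicator {a..b} x * L"])
      show "integrable lborel (\<lambda>x. indicator {a..b} x * L)"
        by (intro integrable_mult_left integrable_real_indicator) (auto simp: emeasure_lborel_Icc_eq)
      show "AE x in lborel. (\<lambda>n. indicator {a..b} x * D n x) \<longlonglongrightarrow> indicator {a..b} x * w x"
        using ae
      proof eventually_elim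
        case (elim x)
        then have "(\<lambda>n. D n x) \<longlonglongrightarrow> w x"
          unfolding D_def DERIV_def by (rule filterlim_compose[OF _ hlim])
        then show ?case by (intro tendsto_intros)
      qed
      show "AE x in lborel. norm (indicator {a..b} x * D n x) \<le> indicator {a..b} x * L" for n
      proof (rule AE_I2)
        fix x
        have "\<bar>V (x + h n) - V x\<bar> \<le> L * h n" using L[of "x + h n" x] h[of n] by simp
        then have "\<bar>D n x\<bar> \<le> L" using h[of n] by (simp add: D_def divide_le_eq)
        then show "norm (indicator {a..b} x * D n x) \<le> indicator {a..b} x * L"
          by (simp add: indicator_def)
      qed
    qed (use w Vm in \<open>auto simp: D_def\<close>)
    moreover have "(\<integral>x. indicator {a..b} x * D n x \<partial>lborel)
        = (W (b + h n) - W b) / h n - (W (a + h n) - W a) / h n" for n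
    proof -
      have "((\<lambda>x. (W (x + h n) - W x) / h n) has_real_derivative D n x) (at x)" for x
        unfolding D_def
        by (intro DERIV_cdivide DERIV_diff W DERIV_shift[THEN iffD1])
      moreover have "continuous_on A (D n)" for A
        unfolding D_def using h[of n]
        by (intro continuous_intros Vc continuous_on_compose2[OF Vc[of UNIV]]) auto
      ultimately have "(LBINT x=a..b. D n x) = (W (b + h n) - W b) / h n - (W (a + h n) - W a) / h n"
        by (intro interval_integral_FTC_finite)
           (auto simp: has_real_derivative_iff_has_vector_derivative[symmetric]
             intro: has_field_derivative_at_within)
      then show ?thesis
        using ab by (simp add: interval_integral_Icc set_lebesgue_integral_def)
    qed
    moreover have "(\<lambda>n. (W (x + h n) - W x) / h n) \<longlonglongrightarrow> V x" for x
      using W[of x] unfolding DERIV_def by (rule filterlim_compose[OF _ hlim])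
    then have "(\<lambda>n. (W (b + h n) - W b) / h n - (W (a + h n) - W a) / h n) \<longlonglongrightarrow> V b - V a"
      by (intro tendsto_intros)
    ultimately have "(\<integral>x. indicator {a..b} x * w x \<partial>lborel) = V b - V a"
      using LIMSEQ_unique by auto
    then show ?thesis using ab by (simp add: interval_integral_Icc set_lebesgue_integral_def)
  qed
  show ?thesis
  proof (cases "a \<le> b")
    case False
    then show ?thesis using *[of b a] by (subst interval_integral_endpoints_reverse) simp
  qed (rule *)
qed

section \<open>Convexity of the Bregman cost in the speed and interpolation of speeds\<close>

context convex_flux
begin

lemma breg_add: "breg u v + breg v u = (u - v) * (g u - g v)"
  by (simp add: breg_def algebra_simps)

text \<open>One nonnegative summand of the symmetrized distance is at most the sum. As
  \<open>u\<close> tends to \<open>v\<close>, the Bregman distance is therefore of smaller order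
  than the speed difference.\<close>

lemma breg_le: "breg u v \<le> \<bar>u - v\<bar> * \<bar>g u - g v\<bar>"
  using breg_add[of u v] breg_nonneg[of v u] abs_ge_self[of "(u - v) * (g u - g v)"]
  by (simp add: abs_mult)

text \<open>The perspective \<open>s B(p/s)\<close> of a strictly convex \<open>B\<close> with \<open>B(0) = 0\<close> is strictly decreasing
  in \<open>s\<close>; here \<open>B\<close> is \<open>breg\<close> as a function of the difference of the speeds.\<close>

lemma breg_perspective:
  assumes st: "0 < s" "s < t" and eq: "s * (g c - g v) = t * (g c - g u)" and "v \<noteq> c"
  shows "t * breg u c < s * breg v c"
proof -
  have "u \<noteq> c" using eq st \<open>v \<noteq> c\<close> by (auto simp: g_eq_iff)
  \<comment> \<open>By \<open>eq\<close>, \<open>t * g u\<close> equals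
    \<open>s * g v + (t - s) * g c\<close>. Expanding all increments of \<open>G\<close> around
    \<open>u\<close> therefore cancels the terms linear in the speeds and leaves Bregman distances
    to \<open>u\<close>.\<close>
  have "s * breg v c - t * breg u c = s * (G v - G u) + (t - s) * (G c - G u)
      - c * (s * (g v - g c) - t * (g u - g c))"
    by (simp add: breg_def algebra_simps)
  also have "s * (g v - g c) - t * (g u - g c) = 0" using eq by (simp add: algebra_simps)
  also have "s * (G v - G u) + (t - s) * (G c - G u) - c * 0 =
      u * (s * (g v - g u) + (t - s) * (g c - g u)) + (s * breg v u + (t - s) * breg c u)"
    by (simp add: G_diff algebra_simps)
  also have "s * (g v - g u) + (t - s) * (g c - g u) = 0" using eq by (simp add: algebra_simps)
  finally have "s * breg v c - t * breg u c = s * breg v u + (t - s) * breg c u" by simp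
  moreover have "(t - s) * breg c u > 0" using breg_pos[of c u] st \<open>u \<noteq> c\<close> by simp
  moreover have "s * breg v u \<ge> 0" using breg_nonneg st by simp
  ultimately show ?thesis by linarith
qed

text \<open>The range of \<open>g\<close> is an interval by the intermediate value theorem. This
  supplies competitors with averaged speeds even when \<open>g\<close> is not onto.\<close>

lemma g_convex_combination:
  assumes "0 \<le> \<theta>" "\<theta> \<le> 1"
  obtains u where "g u = \<theta> * g v + (1 - \<theta>) * g w"
proof (cases "g v \<le> g w")
  case True
  have "\<theta> * (g w - g v) \<ge> 0" "(1 - \<theta>) * (g w - g v) \<ge> 0" using True assms by auto
  then have "g v \<le> \<theta> * g v + (1 - \<theta>) * g w" "\<theta> * g v + (1 - \<theta>) * g w \<le> g w"
    by (auto simp: algebra_simps)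
  then show ?thesis by (rule g_IVT) (use that in blast)
next
  case False
  have "\<theta> * (g v - g w) \<ge> 0" "(1 - \<theta>) * (g v - g w) \<ge> 0" using False assms by auto
  then have "g w \<le> \<theta> * g v + (1 - \<theta>) * g w" "\<theta> * g v + (1 - \<theta>) * g w \<le> g v"
    by (auto simp: algebra_simps)
  then show ?thesis by (rule g_IVT) (use that in blast)
qed

text \<open>A displacement from the characteristic that is attainable in time \<open>s\<close> is
  attainable in the longer time \<open>t\<close>, by averaging the speed with that of
  \<open>c\<close>.\<close>

lemma g_rescale:
  assumes "0 < s" "s < t"
  obtains u where "s * (g c - g v) = t * (g c - g u)"
proof -
  obtain u where "g u = (s / t) * g v + (1 - s / t) * g c"
    using g_convex_combination[of "s / t"] assms by auto
  then have "s * (g c - g v) = t * (g c - g u)" using assms by (simp add: field_simps)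
  then show ?thesis using that by blast
qed

lemma u_loc_eq: "t > 0 \<Longrightarrow> u_loc f (t * (g c - g u)) t c = u"
  by (simp add: u_loc_def inv_g)

lemma eventually_on_characteristic_fan:
  assumes "t > 0"
  shows "\<forall>\<^sub>F l in at 0. \<exists>u. l = t * (g c - g u)"
proof -
  have "((\<lambda>l. g c - l / t) \<longlongrightarrow> g c) (at 0)"
    using assms by (auto intro!: tendsto_eq_intros)
  then have "\<forall>\<^sub>F l in at 0. \<exists>u. g u = g c - l / t"
    by (rule eventually_compose_filterlim[OF eventually_in_range_g])
  then show ?thesis
  proof eventually_elim
    case (elim l)
    then obtain u where "g u = g c - l / t" by blast
    then have "l = t * (g c - g u)" using assms by (simp add: field_simps)
    then show ?case by blast
  qed
qed

end

section \<open>Optimality along a characteristic and the time \<open>tp\<close>\<close>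

context convex_flux_data
begin

text \<open>The two characteristics have foot points differing by \<open>t * (g c - g u)\<close>. In
  view of \<open>F_loc_eq\<close>, the excess is the difference of the two sides of the inequality
  defining \<open>tp\<close>, so optimality of \<open>c\<close> is the global form of that local
  condition.\<close>

lemma H_excess:
  "H u (x0 + t * g c) t - H c (x0 + t * g c) t
    = Phi_loc \<phi> (t * (g c - g u)) x0 c + t * breg u c"
  by (simp add: lax_def Phi_loc_eq[OF Linfty] breg_def algebra_simps)

lemma U_iff_excess:
  assumes "t > 0"
  shows "c \<in> U (x0 + t * g c) t \<longleftrightarrow> (\<forall>u. Phi_loc \<phi> (t * (g c - g u)) x0 c + t * breg u c \<ge> 0)"
  unfolding U_iff[OF assms] H_excess[symmetric] by simp

lemma U_singleton_iff_excess:
  assumes "t > 0"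
  shows "U (x0 + t * g c) t = {c} \<longleftrightarrow> (\<forall>u. u \<noteq> c \<longrightarrow> Phi_loc \<phi> (t * (g c - g u)) x0 c + t * breg u c > 0)"
    (is "?L \<longleftrightarrow> ?R")
proof
  assume L: ?L
  then have "c \<in> U (x0 + t * g c) t" by simp
  then have c: "H c (x0 + t * g c) t \<le> H v (x0 + t * g c) t" for v
    using assms by (simp add: U_iff)
  show ?R
  proof (intro allI impI)
    fix u assume "u \<noteq> c"
    then have "u \<notin> U (x0 + t * g c) t" using L by simp
    then obtain v where "H v (x0 + t * g c) t < H u (x0 + t * g c) t"
      using assms by (auto simp: U_iff not_le)
    with c[of v] show "Phi_loc \<phi> (t * (g c - g u)) x0 c + t * breg u c > 0"
      unfolding H_excess[symmetric] by simp
  qed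
next
  assume R: ?R
  have lt: "H c (x0 + t * g c) t < H u (x0 + t * g c) t" if "u \<noteq> c" for u
    using R that unfolding H_excess[symmetric] by simp
  then have "H c (x0 + t * g c) t \<le> H u (x0 + t * g c) t" for u
    by (cases "u = c") (auto intro: less_imp_le)
  then have "c \<in> U (x0 + t * g c) t" using assms by (simp add: U_iff)
  moreover have "u = c" if "u \<in> U (x0 + t * g c) t" for u
    using that lt[of u] assms by (auto simp: U_iff not_less[symmetric])
  ultimately show ?L by blast
qed

text \<open>Each displacement at time \<open>s\<close> is also one at time \<open>t\<close>, where
  its Bregman cost is strictly smaller; nonnegative excess at \<open>t\<close> thus becomes positive
  excess at \<open>s\<close>.\<close>

lemma U_persistent:
  assumes "c \<in> U (x0 + t * g c) t" "0 < s" "s < t"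
  shows "U (x0 + s * g c) s = {c}"
  unfolding U_singleton_iff_excess[OF assms(2)]
proof (intro allI impI)
  fix v assume "v \<noteq> c"
  obtain u where u: "s * (g c - g v) = t * (g c - g u)" using g_rescale assms by metis
  have "Phi_loc \<phi> (t * (g c - g u)) x0 c + t * breg u c \<ge> 0"
    using assms by (auto simp: U_iff_excess)
  with u breg_perspective[OF assms(2,3) u \<open>v \<noteq> c\<close>]
  show "Phi_loc \<phi> (s * (g c - g v)) x0 c + s * breg v c > 0" by simp
qed

text \<open>The set of times whose supremum is the one-sided \<open>tp\<close>. Keeping the filter
  as a parameter treats the left, the right and the two-sided condition together.\<close>

definition adm :: "real \<Rightarrow> real \<Rightarrow> real filter \<Rightarrow> real set" where
  "adm x0 c F = {t. t > 0 \<and> (\<forall>\<^sub>F l in F. Phi_loc \<phi> l x0 c > F_loc f l t c)}"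

lemma tp_adm: "tp_plus f \<phi> x0 c = Sup (ereal ` adm x0 c (at_right 0))"
  "tp_minus f \<phi> x0 c = Sup (ereal ` adm x0 c (at_left 0))"
  by (simp_all add: tp_plus_def tp_minus_def adm_def)

text \<open>Passes from displacements to states: all sufficiently small displacements come from some
  state \<open>u\<close>, and there the local inequality says that the excess is positive.\<close>

lemma eventually_adm_iff:
  assumes "t > 0"
  shows "(\<forall>\<^sub>F l in at 0. Phi_loc \<phi> l x0 c > F_loc f l t c) \<longleftrightarrow>
    (\<exists>d>0. \<forall>u. u \<noteq> c \<and> \<bar>t * (g c - g u)\<bar> < d \<longrightarrow> Phi_loc \<phi> (t * (g c - g u)) x0 c + t * breg u c > 0)"
    (is "?L \<longleftrightarrow> ?R")
proof
  assume ?L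
  then obtain d where d: "d > 0" "\<And>l. l \<noteq> 0 \<Longrightarrow> \<bar>l\<bar> < d \<Longrightarrow> Phi_loc \<phi> l x0 c > F_loc f l t c"
    by (auto simp: eventually_at)
  show ?R
  proof (intro exI[of _ d] conjI allI impI d(1))
    fix u assume "u \<noteq> c \<and> \<bar>t * (g c - g u)\<bar> < d"
    then show "Phi_loc \<phi> (t * (g c - g u)) x0 c + t * breg u c > 0"
      using d(2)[of "t * (g c - g u)"] assms by (auto simp: F_loc_eq u_loc_eq g_eq_iff)
  qed
next
  assume ?R
  then obtain d where d: "d > 0"
    "\<And>u. u \<noteq> c \<Longrightarrow> \<bar>t * (g c - g u)\<bar> < d \<Longrightarrow> Phi_loc \<phi> (t * (g c - g u)) x0 c + t * breg u c > 0"
    by blast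
  have "\<forall>\<^sub>F l in at 0. l \<noteq> 0 \<and> \<bar>l\<bar> < d" using d(1) by (auto simp: eventually_at)
  with eventually_on_characteristic_fan[OF assms, of c] show ?L
  proof eventually_elim
    case (elim l)
    then obtain u where u: "l = t * (g c - g u)" by blast
    with elim(2) have "u \<noteq> c" "\<bar>t * (g c - g u)\<bar> < d" by auto
    from d(2)[OF this] show ?case using assms u by (simp add: F_loc_eq u_loc_eq)
  qed
qed

lemma adm_at:
  "t \<in> adm x0 c (at 0) \<longleftrightarrow> t \<in> adm x0 c (at_left 0) \<and> t \<in> adm x0 c (at_right 0)"
  by (auto simp: adm_def eventually_at_split)

lemma F_loc_strict_mono:
  assumes "0 < s" "s < t" "l \<noteq> 0" "l = s * (g c - g v)"
  shows "F_loc f l s c < F_loc f l t c"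
proof -
  obtain u where u: "s * (g c - g v) = t * (g c - g u)" using g_rescale assms by metis
  have "F_loc f l s c = - s * breg v c" using assms by (simp add: F_loc_eq u_loc_eq)
  moreover have "F_loc f l t c = - t * breg u c" using assms u by (simp add: F_loc_eq u_loc_eq)
  moreover have "v \<noteq> c" using assms by auto
  ultimately show ?thesis using breg_perspective[OF assms(1,2) u] by simp
qed

text \<open>Since \<open>F_loc\<close> increases with time at a fixed small displacement,
  admissibility is inherited by earlier times. Admissible times on the two sides can then be
  replaced by their minimum.\<close>

lemma adm_downward:
  assumes "t \<in> adm x0 c F" "F \<le> at 0" "0 < s" "s \<le> t"
  shows "s \<in> adm x0 c F"
proof (cases "s = t")
  case False
  then have "s < t" using assms(4) by simp
  have "\<forall>\<^sub>F l in F. \<exists>v. l = s * (g c - g v)"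
    using eventually_on_characteristic_fan[OF assms(3)] assms(2) by (rule filter_leD[rotated])
  moreover have "\<forall>\<^sub>F l in at 0. l \<noteq> (0::real)" by (simp add: eventually_at_filter)
  then have "\<forall>\<^sub>F l in F. l \<noteq> 0" using assms(2) by (rule filter_leD[rotated])
  moreover have "\<forall>\<^sub>F l in F. Phi_loc \<phi> l x0 c > F_loc f l t c" using assms(1) by (simp add: adm_def)
  ultimately have "\<forall>\<^sub>F l in F. Phi_loc \<phi> l x0 c > F_loc f l s c"
  proof eventually_elim
    case (elim l)
    then obtain v where "l = s * (g c - g v)" by blast
    from F_loc_strict_mono[OF assms(3) \<open>s < t\<close> elim(2) this] elim(3) show ?case by simp
  qed
  with assms(3) show ?thesis by (simp add: adm_def)
qed (use assms in simp)

lemma tp_gt_imp_adm: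
  assumes "ereal t < tp f \<phi> x0 c" "t > 0"
  obtains s where "t < s" "s \<in> adm x0 c (at 0)"
proof -
  from assms obtain p q where p: "t < p" "p \<in> adm x0 c (at_right 0)" and q: "t < q" "q \<in> adm x0 c (at_left 0)"
    by (auto simp: tp_def tp_adm less_Sup_iff)
  define s where "s = min p q"
  have le: "at_right 0 \<le> at (0::real)" "at_left 0 \<le> at (0::real)"
    by (simp_all add: at_le)
  have "s \<in> adm x0 c (at_right 0)" "s \<in> adm x0 c (at_left 0)"
    using p q adm_downward[OF p(2) le(1), of s] adm_downward[OF q(2) le(2), of s] assms(2)
    by (auto simp: s_def min_def split: if_splits)
  with that[of s] p q show ?thesis by (auto simp: adm_at s_def)
qed

lemma adm_imp_tp_ge: "t \<in> adm x0 c (at 0) \<Longrightarrow> ereal t \<le> tp f \<phi> x0 c"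
  by (auto simp: tp_def tp_adm adm_at intro!: Sup_upper)

text \<open>At every earlier time \<open>c\<close> is the only maximizer, so the excess is positive
  for all other states, in particular for nearby ones; all earlier times are thus admissible on both
  sides.\<close>

lemma U_imp_tp_ge:
  assumes c: "c \<in> U (x0 + t * g c) t" and t: "t > 0"
  shows "ereal t \<le> tp f \<phi> x0 c"
proof (rule ccontr)
  assume "\<not> ereal t \<le> tp f \<phi> x0 c"
  then have "max 0 (tp f \<phi> x0 c) < ereal t" using t by simp
  then obtain s where s: "max 0 (tp f \<phi> x0 c) < ereal s" "ereal s < ereal t"
    using ereal_dense2 by blast
  then have s': "0 < s" "s < t" "tp f \<phi> x0 c < ereal s" by (auto simp: max_less_iff_conj)
  have "\<forall>u. u \<noteq> c \<longrightarrow> Phi_loc \<phi> (s * (g c - g u)) x0 c + s * breg u c > 0"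
    using U_persistent[OF c s'(1,2)] U_singleton_iff_excess[OF s'(1)] by simp
  then have "s \<in> adm x0 c (at 0)"
    unfolding adm_def using s'(1) eventually_adm_iff[OF s'(1)] by (auto intro!: exI[of _ 1])
  with adm_imp_tp_ge s' show False by (meson not_less)
qed

text \<open>If the local condition still has room after a time at which \<open>c\<close> is the only maximizer, then
  maximizers at slightly later times are close to \<open>c\<close>, and the local condition forces them to be
  \<open>c\<close>.\<close>

lemma U_extend:
  assumes single: "U (x0 + t * g c) t = {c}" and t: "t > 0" and lt: "ereal t < tp f \<phi> x0 c"
  obtains s where "t < s" "c \<in> U (x0 + s * g c) s"
proof -
  obtain r where r: "t < r" "r \<in> adm x0 c (at 0)" using tp_gt_imp_adm[OF lt t] by metis
  obtain d where d: "d > 0"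
    "\<And>u. u \<noteq> c \<Longrightarrow> \<bar>r * (g c - g u)\<bar> < d \<Longrightarrow> Phi_loc \<phi> (r * (g c - g u)) x0 c + r * breg u c > 0"
    using r t unfolding adm_def by (auto simp: eventually_adm_iff)
  \<comment> \<open>Times decreasing to \<open>t\<close>. The denominators start at two, which keeps
    every \<open>s n\<close> strictly below \<open>r\<close>.\<close>
  define s where "s = (\<lambda>n. t + (r - t) / real (Suc (Suc n)))"
  have s: "t < s n" "s n < r" for n
  proof -
    show "t < s n" using r(1) by (simp add: s_def)
    have "(r - t) / real (Suc (Suc n)) < (r - t) / 1"
      using r(1) by (intro divide_strict_left_mono) auto
    then show "s n < r" by (simp add: s_def)
  qed
  have slim: "s \<longlonglongrightarrow> t"
  proof -
    have "(\<lambda>n. (r - t) / real n) \<longlonglongrightarrow> 0" by (rule lim_const_over_n)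
    then have "(\<lambda>n. (r - t) / real (Suc (Suc n))) \<longlonglongrightarrow> 0" by (intro LIMSEQ_Suc)
    then show ?thesis unfolding s_def using tendsto_add[OF tendsto_const[of t]] by fastforce
  qed
  define u where "u = (\<lambda>n. Inf (U (x0 + s n * g c) (s n)))"
  have uU: "u n \<in> U (x0 + s n * g c) (s n)" for n
    unfolding u_def using s[of n] t by (intro Inf_in_U) auto
  have "u \<longlonglongrightarrow> c"
  proof (rule U_tendsto[OF single t uU])
    show "s n > 0" for n using s[of n] t by simp
  qed (intro tendsto_intros slim)+
  then have "(\<lambda>n. s n * (g c - g (u n))) \<longlonglongrightarrow> t * (g c - g c)"
    by (intro tendsto_intros slim isCont_tendsto_compose[OF g_isCont])
  then have "\<forall>\<^sub>F n in sequentially. \<bar>s n * (g c - g (u n))\<bar> < d"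
    using d(1) by (auto simp: tendsto_iff dist_real_def)
  then obtain n where n: "\<bar>s n * (g c - g (u n))\<bar> < d" by (auto simp: eventually_sequentially)
  have "u n = c"
  proof (rule ccontr)
    assume ne: "u n \<noteq> c"
    have sn: "0 < s n" using s[of n] t by simp
    \<comment> \<open>At time \<open>r\<close>, \<open>v\<close> has the displacement that
      \<open>u n\<close> has at time \<open>s n\<close>. Its positive excess, granted by the local
      condition at \<open>r\<close>, passes to \<open>u n\<close> by \<open>breg_perspective\<close>
      and contradicts the optimality of \<open>u n\<close>.\<close>
    obtain v where v: "s n * (g c - g (u n)) = r * (g c - g v)" using g_rescale[OF sn s(2)] by metis
    then have "v \<noteq> c" using ne sn by (auto simp: g_eq_iff)
    then have "Phi_loc \<phi> (r * (g c - g v)) x0 c + r * breg v c > 0" using d(2)[of v] v n by simp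
    with breg_perspective[OF sn s(2) v ne] v
    have "Phi_loc \<phi> (s n * (g c - g (u n))) x0 c + s n * breg (u n) c > 0" by simp
    then have "H c (x0 + s n * g c) (s n) < H (u n) (x0 + s n * g c) (s n)"
      unfolding H_excess[symmetric] by simp
    with uU[of n] sn show False by (auto simp: U_iff not_less[symmetric])
  qed
  with that[of "s n"] s uU[of n] show ?thesis by simp
qed

section \<open>Value function and restart\<close>

text \<open>Backward characteristics do not cross. If the foot points were in the wrong order,
  exchanging them would give competitors \<open>p\<close> at \<open>y\<close> and \<open>q\<close>
  at \<open>x\<close> whose speeds lie strictly between those of \<open>u\<close> and
  \<open>v\<close> and have the same sum; strict convexity of the cost in the speed makes the
  exchange profitable.\<close>

lemma U_foot_mono:
  assumes u: "u \<in> U x t" and v: "v \<in> U y t" and xy: "x < y" and t: "t > 0"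
  shows "x - t * g u \<le> y - t * g v"
proof (rule ccontr)
  assume "\<not> x - t * g u \<le> y - t * g v"
  then have lt: "t * g v - t * g u > y - x" by simp
  \<comment> \<open>The weight for which \<open>p\<close>, started backwards from \<open>y\<close>,
    lands on the foot point of \<open>u\<close>; by symmetry \<open>q\<close> from \<open>x\<close>
    lands on that of \<open>v\<close>.\<close>
  define \<theta> where "\<theta> = (y - x) / (t * g v - t * g u)"
  have \<theta>: "0 < \<theta>" "\<theta> < 1" using lt xy by (auto simp: \<theta>_def divide_less_eq)
  have \<theta>_eq: "y - x = \<theta> * (t * g v - t * g u)"
    unfolding \<theta>_def by (rule nonzero_divide_eq_eq[THEN iffD1, OF _ refl]) (use lt xy in linarith)
  obtain p where p: "g p = \<theta> * g v + (1 - \<theta>) * g u" using g_convex_combination[of \<theta>] \<theta> by auto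
  obtain q where q: "g q = \<theta> * g u + (1 - \<theta>) * g v" using g_convex_combination[of \<theta>] \<theta> by auto
  have "t * (g v - g u) > 0" using lt xy by (simp add: right_diff_distrib)
  then have guv: "g u < g v" using t by (simp add: zero_less_mult_iff)
  have tp: "y - t * g p = x - t * g u" using \<theta>_eq by (simp add: p algebra_simps)
  have tq: "x - t * g q = y - t * g v" using \<theta>_eq by (simp add: q algebra_simps)
  have "H u x t \<le> H q x t" "H v y t \<le> H p y t" using u v t by (simp_all add: U_iff)
  then have "t * (G u + G v) \<le> t * (G q + G p)" unfolding lax_def tp tq by (simp add: algebra_simps)
  then have le: "G u + G v \<le> G q + G p" using t by simp
  have up: "u \<noteq> p" "u \<noteq> q"
  proof -
    have "g p - g u = \<theta> * (g v - g u)" "g q - g u = (1 - \<theta>) * (g v - g u)"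
      by (simp_all add: p q algebra_simps)
    moreover have "\<theta> * (g v - g u) > 0" "(1 - \<theta>) * (g v - g u) > 0" using \<theta> guv by simp_all
    ultimately show "u \<noteq> p" "u \<noteq> q" by auto
  qed
  have sum: "g u + g v = g p + g q" by (simp add: p q algebra_simps)
  show False
  \<comment> \<open>The order of \<open>p\<close> and \<open>q\<close> decides which of them is
    paired with \<open>u\<close>, so that the mixed product is nonnegative.\<close>
  proof (cases "p \<le> q")
    case True
    have "(G u - G p) + (G v - G q) = (q - p) * (g v - g q) + breg u p + breg v q"
    proof -
      have eq: "g u - g p = - (g v - g q)" using sum by simp
      show ?thesis unfolding G_diff[of u p] G_diff[of v q] eq by (simp add: algebra_simps)
    qed
    moreover have "g v - g q = \<theta> * (g v - g u)" by (simp add: q algebra_simps)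
    then have "(q - p) * (g v - g q) \<ge> 0" using True \<theta> guv by simp
    ultimately show False using le breg_pos[OF up(1)] breg_nonneg[of v q] by linarith
  next
    case False
    have "(G u - G q) + (G v - G p) = (p - q) * (g v - g p) + breg u q + breg v p"
    proof -
      have eq: "g u - g q = - (g v - g p)" using sum by simp
      show ?thesis unfolding G_diff[of u q] G_diff[of v p] eq by (simp add: algebra_simps)
    qed
    moreover have "g v - g p = (1 - \<theta>) * (g v - g u)" by (simp add: p algebra_simps)
    then have "(p - q) * (g v - g p) \<ge> 0" using False \<theta> guv by simp
    ultimately show False using le breg_pos[OF up(2)] breg_nonneg[of v p] by linarith
  qed
qed

text \<open>At a point with several maximizers, the extreme foot points span a nonempty open
  interval. By \<open>U_foot_mono\<close> these intervals are disjoint for different points, so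
  there are countably many.\<close>

lemma countable_multivalued:
  assumes t: "t > 0"
  shows "countable {x. \<not> (\<exists>c. U x t = {c})}" (is "countable ?B")
proof -
  define I where "I = (\<lambda>x. {x - t * g (Sup (U x t)) <..< x - t * g (Inf (U x t))})"
  have ne: "I x \<noteq> {}" if "x \<in> ?B" for x
  proof -
    have bd: "bdd_below (U x t)" "bdd_above (U x t)"
      using compact_imp_bounded[OF U_compact[OF t, of x]]
      by (simp_all add: bounded_imp_bdd_below bounded_imp_bdd_above)
    have "Inf (U x t) \<le> Sup (U x t)" by (rule cInf_lower[OF Sup_in_U[OF t] bd(1)])
    moreover have "Inf (U x t) \<noteq> Sup (U x t)"
      using traces_eq_iff[OF t, of x] that by (auto simp: trace_left_def trace_right_def)
    ultimately have "g (Inf (U x t)) < g (Sup (U x t))" by (simp add: g_less_iff)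
    then show ?thesis using t by (simp add: I_def)
  qed
  have disj: "I x \<inter> I y = {}" if "x < y" for x y
    using U_foot_mono[OF Inf_in_U[OF t] Sup_in_U[OF t] that t] by (auto simp: I_def)
  have inj: "inj_on I ?B"
  proof (rule inj_onI)
    fix x y assume "x \<in> ?B" "y \<in> ?B" "I x = I y"
    then show "x = y" using disj[of x y] disj[of y x] ne[of x] by (cases x y rule: linorder_cases) auto
  qed
  have "disjoint (I ` ?B)"
    unfolding pairwise_def disjnt_def using disj by (metis (no_types, lifting) imageE inf_commute linorder_neqE)
  then have "countable (I ` ?B)"
    by (rule countable_disjoint_open_subsets[rotated]) (auto simp: I_def)
  then show ?thesis using inj by (rule countable_image_inj_on)
qed

text \<open>The foot point of the entropy solution is monotone in \<open>x\<close>, hence Borel.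
  Since \<open>g\<close> is strictly increasing, the superlevel sets of the solution are superlevel
  sets of \<open>x\<close> minus the foot point.\<close>

lemma Linfty_entropy_sol:
  assumes t: "t > 0"
  shows "(\<lambda>x. entropy_sol f \<phi> x t) \<in> borel_measurable borel" "Linfty_fun (\<lambda>x. entropy_sol f \<phi> x t)"
proof -
  let ?w = "\<lambda>x. entropy_sol f \<phi> x t"
  have wU: "?w x \<in> U x t" for x unfolding entropy_sol_def by (rule Inf_in_U[OF t])
  have "mono (\<lambda>x. x - t * g (?w x))"
    unfolding mono_def using U_foot_mono[OF wU wU _ t] by (metis order.order_iff_strict)
  then have m [measurable]: "(\<lambda>x. x - t * g (?w x)) \<in> borel_measurable borel" by (rule borel_measurable_mono)
  have "{x \<in> space borel. a \<le> ?w x} \<in> sets borel" for a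
  proof -
    have "{x \<in> space borel. a \<le> ?w x} = {x \<in> space borel. t * g a \<le> x - (x - t * g (?w x))}"
      using t by (auto simp: g_le_iff)
    also have "\<dots> \<in> sets borel" by measurable
    finally show ?thesis .
  qed
  then show wm: "?w \<in> borel_measurable borel" unfolding borel_measurable_iff_ge by auto
  obtain M where "\<And>x t. t > 0 \<Longrightarrow> U x t \<subseteq> {-M..M}" using U_bounded by metis
  then have "?w x \<in> {-M..M}" for x using wU t by blast
  then have "\<bar>?w x\<bar> \<le> M" for x by (auto simp: abs_le_iff minus_le_iff)
  then show "Linfty_fun ?w" using wm by (auto simp: Linfty_fun_def measurable_completion)
qed

section \<open>The value function as a primitive of the entropy solution\<close>

definition V :: "real \<Rightarrow> real \<Rightarrow> real" where "V x t = H (entropy_sol f \<phi> x t) x t"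

lemma V_le: "t > 0 \<Longrightarrow> V x t \<le> H u x t"
  using Inf_in_U[of t x] by (simp add: V_def entropy_sol_def U_iff)

lemma V_eq: "t > 0 \<Longrightarrow> u \<in> U x t \<Longrightarrow> V x t = H u x t"
  using Inf_in_U[of t x] by (intro antisym) (auto simp: V_def entropy_sol_def U_iff)

lemma V_attained: "t > 0 \<Longrightarrow> \<exists>u. V x t = H u x t"
  by (auto simp: V_def)

text \<open>A minimizing state at \<open>y\<close>, used as a competitor at \<open>x\<close>, has
  its foot point shifted by \<open>x - y\<close>, so the Lipschitz constant of
  \<open>Phi \<phi>\<close> is inherited.\<close>

lemma V_lipschitz:
  assumes t: "t > 0"
  obtains M where "\<And>x y. \<bar>V x t - V y t\<bar> \<le> M * \<bar>x - y\<bar>"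
proof -
  obtain M where M: "\<And>x y. \<bar>Phi \<phi> x - Phi \<phi> y\<bar> \<le> M * \<bar>x - y\<bar>" using Phi_lipschitz[OF Linfty] by metis
  have *: "V x t - V y t \<le> M * \<bar>x - y\<bar>" for x y
  proof -
    obtain u where "V y t = H u y t" using V_attained[OF t] by blast
    then have "V x t - V y t \<le> H u x t - H u y t" using V_le[OF t, of x u] by simp
    also have "\<dots> \<le> M * \<bar>x - y\<bar>" using M[of "x - t * g u" "y - t * g u"] by (simp add: lax_def)
    finally show ?thesis .
  qed
  have "\<bar>V x t - V y t\<bar> \<le> M * \<bar>x - y\<bar>" for x y
    using *[of x y] *[of y x] by (simp add: abs_le_iff abs_minus_commute)
  then show ?thesis by (rule that)
qed

text \<open>Compare with the competitor at \<open>y\<close> that has the same foot point.\<close>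

lemma V_one_sided:
  assumes t: "t > 0" and u: "u \<in> U x t" and eq: "t * (g v - g u) = y - x"
  shows "V y t - V x t \<le> v * (y - x)"
proof -
  have foot: "y - t * g v = x - t * g u" using eq by (simp add: algebra_simps)
  have "V y t - V x t \<le> H v y t - H u x t" using V_le[OF t, of y v] V_eq[OF t u] by simp
  also have "\<dots> = t * (G v - G u)" unfolding lax_def foot by (simp add: algebra_simps)
  also have "G v - G u = v * (g v - g u) - breg u v" by (simp add: breg_def algebra_simps)
  also have "t * \<dots> \<le> v * (t * (g v - g u))" using t breg_nonneg[of u v] by (simp add: algebra_simps)
  finally show ?thesis by (simp add: eq)
qed

text \<open>\<open>V_one_sided\<close>, applied once from \<open>x\<close> and once from
  \<open>y\<close>, traps the difference quotient between two states that both tend to the unique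
  maximizer \<open>c\<close>.\<close>

lemma V_has_derivative:
  assumes t: "t > 0" and single: "U x t = {c}"
  shows "((\<lambda>y. V y t) has_real_derivative c) (at x)"
proof -
  let ?w = "\<lambda>y. entropy_sol f \<phi> y t"
  have wU: "?w y \<in> U y t" for y unfolding entropy_sol_def by (rule Inf_in_U[OF t])
  have wlim: "(?w \<longlongrightarrow> c) (at x)"
    unfolding tendsto_at_iff_sequentially o_def
  proof (intro allI impI)
    fix X assume "X \<longlonglongrightarrow> x"
    then show "(\<lambda>n. ?w (X n)) \<longlonglongrightarrow> c"
      by (intro U_tendsto[OF single t wU]) (auto simp: t)
  qed
  have lim0: "((\<lambda>y. (y - x) / t) \<longlongrightarrow> 0) (at x)" using t by (auto intro!: tendsto_eq_intros)
  have A: "((\<lambda>y. g c + (y - x) / t) \<longlongrightarrow> g c) (at x)"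
    using tendsto_add[OF tendsto_const[of "g c"] lim0] by simp
  have B: "((\<lambda>y. g (?w y) - (y - x) / t) \<longlongrightarrow> g c) (at x)"
    using tendsto_diff[OF isCont_tendsto_compose[OF g_isCont wlim] lim0] by simp
  \<comment> \<open>At \<open>y\<close>, the state \<open>a y\<close> has the foot point of
    \<open>c\<close> at \<open>x\<close>; at \<open>x\<close>, the state \<open>b y\<close> has the
    foot point of the maximizer at \<open>y\<close>.\<close>
  define a where "a = (\<lambda>y. inv g (g c + (y - x) / t))"
  define b where "b = (\<lambda>y. inv g (g (?w y) - (y - x) / t))"
  have a: "(a \<longlongrightarrow> c) (at x)" and b: "(b \<longlongrightarrow> c) (at x)"
    unfolding a_def b_def
    using isCont_tendsto_compose[OF inv_g_cont A] isCont_tendsto_compose[OF inv_g_cont B]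
    unfolding inv_g .
  have "\<forall>\<^sub>F y in at x. \<exists>u. g u = g c + (y - x) / t" "\<forall>\<^sub>F y in at x. \<exists>u. g u = g (?w y) - (y - x) / t"
    using eventually_compose_filterlim[OF eventually_in_range_g A]
      eventually_compose_filterlim[OF eventually_in_range_g B] .
  moreover have "\<forall>\<^sub>F y in at x. y \<noteq> x" by (simp add: eventually_at_filter)
  ultimately have "\<forall>\<^sub>F y in at x. min (a y) (b y) \<le> (V y t - V x t) / (y - x)
      \<and> (V y t - V x t) / (y - x) \<le> max (a y) (b y)"
  proof eventually_elim
    case (elim y)
    from elim(1) obtain p where p: "g p = g c + (y - x) / t" ..
    from elim(2) obtain q where q: "g q = g (?w y) - (y - x) / t" ..
    have "g (a y) = g c + (y - x) / t" unfolding a_def p[symmetric] inv_g ..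
    then have "t * (g (a y) - g c) = y - x" using t by simp
    then have 1: "V y t - V x t \<le> a y * (y - x)" using V_one_sided[OF t, of c x "a y" y] single by simp
    have "g (b y) = g (?w y) - (y - x) / t" unfolding b_def q[symmetric] inv_g ..
    then have "t * (g (b y) - g (?w y)) = x - y" using t by simp
    then have "V x t - V y t \<le> b y * (x - y)" by (rule V_one_sided[OF t wU])
    then have 2: "V y t - V x t \<ge> b y * (y - x)" by (simp add: algebra_simps)
    \<comment> \<open>Division by \<open>y - x\<close> reverses both bounds to the left of
      \<open>x\<close>, whence \<open>min\<close> and \<open>max\<close> in the claim.\<close>
    show ?case
    proof (cases "x < y")
      case True
      then have "b y \<le> (V y t - V x t) / (y - x)" "(V y t - V x t) / (y - x) \<le> a y"
        using 1 2 by (simp_all add: pos_le_divide_eq pos_divide_le_eq)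
      then show ?thesis by (auto simp: min_def max_def)
    next
      case False
      then have "y < x" using elim(3) by simp
      then have "a y \<le> (V y t - V x t) / (y - x)" "(V y t - V x t) / (y - x) \<le> b y"
        using 1 2 by (simp_all add: neg_le_divide_eq neg_divide_le_eq)
      then show ?thesis by (auto simp: min_def max_def)
    qed
  qed
  then have ev: "\<forall>\<^sub>F y in at x. min (a y) (b y) \<le> (V y t - V x t) / (y - x)"
    "\<forall>\<^sub>F y in at x. (V y t - V x t) / (y - x) \<le> max (a y) (b y)"
    by (simp_all add: eventually_conj_iff)
  have lims: "((\<lambda>y. min (a y) (b y)) \<longlongrightarrow> c) (at x)" "((\<lambda>y. max (a y) (b y)) \<longlongrightarrow> c) (at x)"
    using tendsto_min[OF a b] tendsto_max[OF a b] by simp_all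
  show ?thesis
    unfolding has_field_derivative_iff by (rule tendsto_sandwich[OF ev lims])
qed

text \<open>Off the countable set with several maximizers, \<open>V\<close> is differentiable with
  the entropy solution as derivative, and \<open>V\<close> is Lipschitz. The restarted problem
  therefore has \<open>V\<close> as primitive of its datum, up to a constant.\<close>

lemma Phi_entropy_sol:
  assumes t: "t > 0"
  shows "Phi (\<lambda>x. entropy_sol f \<phi> x t) x = V x t - V 0 t"
proof -
  let ?w = "\<lambda>y. entropy_sol f \<phi> y t"
  obtain M where M: "\<And>x y. \<bar>V x t - V y t\<bar> \<le> M * \<bar>x - y\<bar>" using V_lipschitz[OF t] by metis
  have "AE x in lborel. x \<notin> {x. \<not> (\<exists>c. U x t = {c})}"
    by (intro AE_not_in countable_imp_null_set_lborel countable_multivalued t)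
  then have ae: "AE x in lborel. ((\<lambda>y. V y t) has_real_derivative ?w x) (at x)"
  proof eventually_elim
    case (elim x)
    then obtain c where c: "U x t = {c}" by blast
    with V_has_derivative[OF t c] show ?case by (simp add: entropy_sol_def)
  qed
  have "Phi ?w x = (LBINT y=0..x. ?w y)"
    unfolding Phi_def
    by (subst interval_lebesgue_integral_lebesgue_eq_lborel[OF Linfty_entropy_sol(1)[OF t]])
       (simp add: zero_ereal_def)
  also have "\<dots> = V x t - V 0 t"
    using interval_integral_lipschitz_FTC[OF M Linfty_entropy_sol(1)[OF t] ae, of 0 x]
    by (simp add: zero_ereal_def)
  finally show ?thesis .
qed

section \<open>The restarted problem and the semigroup property\<close>

lemma maximizers_restart_iff:
  assumes \<tau>: "\<tau> > 0" and t: "t > \<tau>"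
  shows "c \<in> maximizers_restart f \<phi> \<tau> x t \<longleftrightarrow>
    (\<forall>v. V (x - (t - \<tau>) * g c) \<tau> + (t - \<tau>) * G c \<le> V (x - (t - \<tau>) * g v) \<tau> + (t - \<tau>) * G v)"
proof -
  let ?w = "\<lambda>y. entropy_sol f \<phi> y \<tau>"
  \<comment> \<open>Restarting is the original problem with datum \<open>?w\<close> and elapsed time
    \<open>t - \<tau>\<close>; the constant \<open>V 0 \<tau>\<close> then cancels in the
    comparison.\<close>
  have "maximizers_restart f \<phi> \<tau> x t = maximizers f ?w x (t - \<tau>)"
    by (simp add: maximizers_restart_def maximizers_def E_restart_def E_fun_def)
  then show ?thesis
    using maximizers_iff[OF Linfty_entropy_sol(2)[OF \<tau>], of "t - \<tau>"] t
    by (simp add: lax_def Phi_entropy_sol[OF \<tau>])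
qed

lemma char_values_restart_iff:
  assumes \<tau>: "\<tau> > 0"
  shows "c \<in> char_values_restart f \<phi> \<tau> x \<longleftrightarrow>
    (\<exists>s>0. \<forall>v. V x \<tau> + s * G c \<le> V (x + s * (g c - g v)) \<tau> + s * G v)"
proof -
  have "c \<in> char_values_restart f \<phi> \<tau> x \<longleftrightarrow> (\<exists>t>\<tau>. \<forall>v. V x \<tau> + (t - \<tau>) * G c
      \<le> V (x + (t - \<tau>) * (g c - g v)) \<tau> + (t - \<tau>) * G v)"
    using maximizers_restart_iff[OF \<tau>] by (auto simp: char_values_restart_def algebra_simps)
  also have "\<dots> \<longleftrightarrow> (\<exists>s>0. \<forall>v. V x \<tau> + s * G c \<le> V (x + s * (g c - g v)) \<tau> + s * G v)"
  proof safe
    fix t assume "t > \<tau>" "\<forall>v. V x \<tau> + (t - \<tau>) * G c \<le> V (x + (t - \<tau>) * (g c - g v)) \<tau> + (t - \<tau>) * G v"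
    then show "\<exists>s>0. \<forall>v. V x \<tau> + s * G c \<le> V (x + s * (g c - g v)) \<tau> + s * G v"
      by (intro exI[of _ "t - \<tau>"]) auto
  next
    fix s :: real assume "s > 0" "\<forall>v. V x \<tau> + s * G c \<le> V (x + s * (g c - g v)) \<tau> + s * G v"
    then show "\<exists>t>\<tau>. \<forall>v. V x \<tau> + (t - \<tau>) * G c \<le> V (x + (t - \<tau>) * (g c - g v)) \<tau> + (t - \<tau>) * G v"
      by (intro exI[of _ "\<tau> + s"]) auto
  qed
  finally show ?thesis .
qed

text \<open>Optimality of \<open>a\<close> bounds the increment of \<open>V\<close> at
  \<open>x\<close> from below by \<open>a * h\<close> up to an error of order \<open>o(h)\<close>.
  As \<open>V\<close> has derivative \<open>c\<close> there, the right and the left difference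
  quotients give \<open>a \<le> c\<close> and \<open>c \<le> a\<close>.\<close>

lemma restart_value_unique:
  assumes t: "t > 0" and single: "U x t = {c}" and s: "s > 0"
    and opt: "\<And>v. V x t + s * G a \<le> V (x + s * (g a - g v)) t + s * G v"
  shows "a = c"
proof -
  \<comment> \<open>The competitor that, traced back over the time \<open>s\<close> from the
    terminal point of \<open>a\<close>, arrives at \<open>x + h\<close>.\<close>
  define v where "v = (\<lambda>h. inv g (g a - h / s))"
  let ?q = "\<lambda>h. (V (x + h) t - V x t) / h"
  have lim: "((\<lambda>h. g a - h / s) \<longlongrightarrow> g a) (at 0)" using s by (auto intro!: tendsto_eq_intros)
  have vlim: "(v \<longlongrightarrow> a) (at 0)"
    unfolding v_def using isCont_tendsto_compose[OF inv_g_cont lim] by (simp add: inv_g)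
  have q: "(?q \<longlongrightarrow> c) (at 0)" using V_has_derivative[OF t single] by (simp add: DERIV_def)
  have key: "\<forall>\<^sub>F h in at 0. a * h - \<bar>v h - a\<bar> * \<bar>h\<bar> \<le> V (x + h) t - V x t"
  proof -
    have "\<forall>\<^sub>F h in at 0. \<exists>u. g u = g a - h / s"
      by (rule eventually_compose_filterlim[OF eventually_in_range_g lim])
    then show ?thesis
    proof eventually_elim
      case (elim h)
      then obtain u where u: "g u = g a - h / s" by blast
      then have gv: "g (v h) = g a - h / s" unfolding v_def u[symmetric] inv_g ..
      then have h: "s * (g a - g (v h)) = h" using s by simp
      have "s * breg (v h) a \<le> s * (\<bar>v h - a\<bar> * \<bar>g (v h) - g a\<bar>)"
        using breg_le s by (intro mult_left_mono) auto
      also have "\<dots> = \<bar>v h - a\<bar> * \<bar>h\<bar>" using s by (simp add: gv abs_mult)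
      finally have "s * breg (v h) a \<le> \<bar>v h - a\<bar> * \<bar>h\<bar>" .
      moreover have "s * (G a - G (v h)) = a * (s * (g a - g (v h))) - s * breg (v h) a"
        by (simp add: breg_def algebra_simps)
      moreover have "s * (G a - G (v h)) \<le> V (x + h) t - V x t"
        using opt[of "v h"] unfolding h by (simp add: algebra_simps)
      ultimately show ?case using h by simp
    qed
  qed
  have le: "at_right 0 \<le> at (0::real)" "at_left 0 \<le> at (0::real)" by (simp_all add: at_le)
  have "a \<le> c"
  proof (rule tendsto_le)
    show "((\<lambda>h. a - \<bar>v h - a\<bar>) \<longlongrightarrow> a) (at_right 0)"
      using tendsto_mono[OF le(1) vlim] by (auto intro!: tendsto_eq_intros)
    show "(?q \<longlongrightarrow> c) (at_right 0)" using tendsto_mono[OF le(1) q] .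
    have "\<forall>\<^sub>F h in at_right 0. h > (0::real)" by (simp add: eventually_at_right_less)
    with filter_leD[OF le(1) key] show "\<forall>\<^sub>F h in at_right 0. a - \<bar>v h - a\<bar> \<le> ?q h"
      by eventually_elim (subst pos_le_divide_eq; simp add: algebra_simps)
  qed simp
  moreover have "c \<le> a"
  proof (rule tendsto_le)
    show "((\<lambda>h. a + \<bar>v h - a\<bar>) \<longlongrightarrow> a) (at_left 0)"
      using tendsto_mono[OF le(2) vlim] by (auto intro!: tendsto_eq_intros)
    show "(?q \<longlongrightarrow> c) (at_left 0)" using tendsto_mono[OF le(2) q] .
    have "\<forall>\<^sub>F h in at_left 0. h < (0::real)" by (auto simp: eventually_at_filter)
    with filter_leD[OF le(2) key] show "\<forall>\<^sub>F h in at_left 0. ?q h \<le> a + \<bar>v h - a\<bar>"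
      by eventually_elim (subst neg_divide_le_eq; simp add: algebra_simps)
  qed simp
  ultimately show ?thesis by simp
qed

text \<open>A restarted value must be \<open>c\<close>. Its optimality after the restart gives
  optimality from time zero, because a straight competitor passes through a point at time \<tau>
  where \<open>V\<close> is at most its cost. Conversely, a path broken at \<tau> costs at least as
  much as a straight one with the same ends.\<close>

lemma char_values_restart_empty_iff:
  assumes \<tau>: "\<tau> > 0" and single: "U (x0 + \<tau> * g c) \<tau> = {c}"
  shows "char_values_restart f \<phi> \<tau> (x0 + \<tau> * g c) = {} \<longleftrightarrow> \<not> (\<exists>t>\<tau>. c \<in> U (x0 + t * g c) t)"
proof -
  let ?x = "x0 + \<tau> * g c"
  have Vx: "V ?x \<tau> = H c ?x \<tau>" using V_eq[OF \<tau>, of c ?x] single by simp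
  have "\<exists>t>\<tau>. c \<in> U (x0 + t * g c) t" if a: "a \<in> char_values_restart f \<phi> \<tau> ?x" for a
  proof -
    obtain s where s: "s > 0" and opt: "\<And>v. V ?x \<tau> + s * G a \<le> V (?x + s * (g a - g v)) \<tau> + s * G v"
      using a by (auto simp: char_values_restart_iff[OF \<tau>])
    have ac: "a = c" by (rule restart_value_unique[OF \<tau> single s opt])
    let ?X = "x0 + (\<tau> + s) * g c"
    have "H c ?X (\<tau> + s) \<le> H v ?X (\<tau> + s)" for v
    proof -
      let ?z = "?x + s * (g c - g v)"
      have "H c ?X (\<tau> + s) = V ?x \<tau> + s * G c" by (simp add: Vx lax_def algebra_simps)
      also have "\<dots> \<le> V ?z \<tau> + s * G v" using opt[of v] ac by simp
      also have "\<dots> \<le> H v ?z \<tau> + s * G v" using V_le[OF \<tau>] by simp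
      also have "\<dots> = H v ?X (\<tau> + s)" by (simp add: lax_def algebra_simps)
      finally show ?thesis .
    qed
    then have "c \<in> U ?X (\<tau> + s)" using \<tau> s by (simp add: U_iff)
    then show ?thesis using s by (intro exI[of _ "\<tau> + s"]) auto
  qed
  moreover have "c \<in> char_values_restart f \<phi> \<tau> ?x" if t: "t > \<tau>" and c: "c \<in> U (x0 + t * g c) t" for t
    unfolding char_values_restart_iff[OF \<tau>]
  proof (intro exI[of _ "t - \<tau>"] conjI allI)
    fix v
    let ?z = "?x + (t - \<tau>) * (g c - g v)" and ?X = "x0 + t * g c"
    obtain w where w: "V ?z \<tau> = H w ?z \<tau>" using V_attained[OF \<tau>] by blast
    \<comment> \<open>The speed of \<open>u\<close> is the time average of \<open>w\<close> before
      \<tau> and \<open>v\<close> after it, so the straight path has the same foot point as the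
      broken one; convexity of the cost makes it no dearer.\<close>
    obtain u where "g u = (\<tau> / t) * g w + (1 - \<tau> / t) * g v"
      using g_convex_combination[of "\<tau> / t"] \<tau> t by auto
    then have u: "t * g u = \<tau> * g w + (t - \<tau>) * g v" using \<tau> t by (simp add: field_simps)
    have "t * G u \<le> \<tau> * G w + (t - \<tau>) * G v"
    proof -
      have "\<tau> * G w + (t - \<tau>) * G v - t * G u = \<tau> * (G w - G u) + (t - \<tau>) * (G v - G u)"
        by (simp add: algebra_simps)
      also have "\<dots> = u * (\<tau> * g w + (t - \<tau>) * g v - t * g u) + (\<tau> * breg w u + (t - \<tau>) * breg v u)"
        by (simp add: G_diff algebra_simps)
      also have "\<dots> = \<tau> * breg w u + (t - \<tau>) * breg v u" by (simp add: u)
      also have "\<dots> \<ge> 0" using \<tau> t breg_nonneg by simp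
      finally show ?thesis by simp
    qed
    moreover have "V ?x \<tau> + (t - \<tau>) * G c = H c ?X t" by (simp add: Vx lax_def algebra_simps)
    moreover have "H c ?X t \<le> H u ?X t" using c \<tau> t by (simp add: U_iff)
    moreover have "?X - t * g u = ?z - \<tau> * g w" by (simp add: u algebra_simps)
    ultimately show "V ?x \<tau> + (t - \<tau>) * G c \<le> V ?z \<tau> + (t - \<tau>) * G v"
      by (simp add: w lax_def)
  qed (use t in simp)
  ultimately show ?thesis by blast
qed

text \<open>For a unique maximizer, \<open>U_extend\<close> and \<open>U_imp_tp_ge\<close> show that
  \<open>c\<close> is optimal at some later time iff \<open>t\<close> is below \<open>tp\<close>.
  Since \<open>t\<close> never exceeds \<open>tp\<close> here, an empty restart set means
  equality.\<close>

lemma cont_shock_gen_point_iff: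
  assumes t: "t > 0" and c: "c \<in> U (x0 + t * g c) t"
  shows "cont_shock_gen_point f \<phi> (x0 + t * g c) t \<longleftrightarrow> U (x0 + t * g c) t = {c} \<and> tp f \<phi> x0 c = ereal t"
proof (cases "U (x0 + t * g c) t = {c}")
  case True
  have "(\<exists>s>t. c \<in> U (x0 + s * g c) s) \<longleftrightarrow> ereal t < tp f \<phi> x0 c"
  proof
    assume "\<exists>s>t. c \<in> U (x0 + s * g c) s"
    then obtain s where s: "t < s" "c \<in> U (x0 + s * g c) s" by blast
    have "ereal t < ereal s" using s(1) by simp
    also have "\<dots> \<le> tp f \<phi> x0 c" using U_imp_tp_ge[OF s(2)] s(1) t by simp
    finally show "ereal t < tp f \<phi> x0 c" .
  next
    assume "ereal t < tp f \<phi> x0 c"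
    from U_extend[OF True t this] show "\<exists>s>t. c \<in> U (x0 + s * g c) s" by blast
  qed
  then show ?thesis
    using True U_imp_tp_ge[OF c t] t char_values_restart_empty_iff[OF t True]
    by (auto simp: cont_shock_gen_point_def traces_eq_iff[OF t])
next
  case False
  with c show ?thesis by (auto simp: cont_shock_gen_point_def traces_eq_iff[OF t])
qed

end

section \<open>Power asymptotics\<close>

lemma set_integral_powr_from_0:
  fixes \<gamma> y :: real
  assumes "\<gamma> > 0" "y \<ge> 0"
  shows "set_integrable lborel {0..y} (\<lambda>s. s powr \<gamma>)"
    "(LBINT s:{0..y}. s powr \<gamma>) = y powr (1 + \<gamma>) / (1 + \<gamma>)"
proof -
  have "continuous_on {0..y} (\<lambda>s. s powr \<gamma>)"
    using assms by (intro continuous_on_powr' continuous_intros) auto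
  then show int: "set_integrable lborel {0..y} (\<lambda>s. s powr \<gamma>)"
    by (rule borel_integrable_atLeastAtMost')
  have "integral {0..y} (\<lambda>s. s powr \<gamma>) = y powr (\<gamma> + 1) / (\<gamma> + 1)"
    using has_integral_powr_from_0[of \<gamma> y] assms by (intro integral_unique) auto
  with set_borel_integral_eq_integral(2)[OF int]
  show "(LBINT s:{0..y}. s powr \<gamma>) = y powr (1 + \<gamma>) / (1 + \<gamma>)" by (simp add: add.commute)
qed

text \<open>A change of variables for germs at \<open>0+\<close>: \<open>m\<close> tends to
  \<open>0+\<close>, and by the intermediate value theorem it reaches every small positive value. It
  replaces displacements by increments of the state.\<close>

lemma eventually_at_right_0_strict_mono_iff:
  fixes m :: "real \<Rightarrow> real"
  assumes cont: "continuous_on UNIV m" and mono: "\<And>x y. x < y \<Longrightarrow> m x < m y" and "m 0 = 0"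
  shows "(\<forall>\<^sub>F y in at_right 0. P y) \<longleftrightarrow> (\<forall>\<^sub>F h in at_right 0. P (m h))"
proof
  have "(m \<longlongrightarrow> m 0) (at_right 0)"
    using cont by (auto simp: continuous_on_def intro: tendsto_within_subset)
  moreover have "\<forall>\<^sub>F h in at_right 0. m h \<in> {0<..} \<and> m h \<noteq> 0"
    using eventually_at_right_less[of 0] by eventually_elim (use mono[of 0] \<open>m 0 = 0\<close> in force)
  ultimately have "filterlim m (at_right 0) (at_right 0)"
    using \<open>m 0 = 0\<close> by (simp add: filterlim_at)
  then show "\<forall>\<^sub>F y in at_right 0. P y \<Longrightarrow> \<forall>\<^sub>F h in at_right 0. P (m h)"
    by (rule eventually_compose_filterlim[rotated])
next
  assume "\<forall>\<^sub>F h in at_right 0. P (m h)"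
  then obtain b where b: "b > 0" "\<And>h. 0 < h \<Longrightarrow> h < b \<Longrightarrow> P (m h)"
    by (auto simp: eventually_at_right[of 0 1])
  have "P y" if "0 < y" "y < m b" for y
  proof -
    have "\<exists>h\<ge>0. h \<le> b \<and> m h = y"
      using that b(1) \<open>m 0 = 0\<close> cont by (intro IVT') (auto intro: continuous_on_subset)
    then obtain h where h: "0 \<le> h" "h \<le> b" "m h = y" by blast
    then have "h \<noteq> 0" "h \<noteq> b" using that \<open>m 0 = 0\<close> by auto
    with h b(2)[of h] show ?thesis by simp
  qed
  moreover have "m b > 0" using mono[OF b(1)] \<open>m 0 = 0\<close> by simp
  ultimately show "\<forall>\<^sub>F y in at_right 0. P y"
    by (auto simp: eventually_at_right[of 0 "m b"])
qed

text \<open>Near zero \<theta> lies a.e. between \<open>(C - \<epsilon>) * s powr \<gamma>\<close>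
  and \<open>(C + \<epsilon>) * s powr \<gamma>\<close>, and both bounds integrate
  explicitly.\<close>

lemma integral_power_asymptotics:
  fixes \<theta> :: "real \<Rightarrow> real"
  assumes m: "\<theta> \<in> borel_measurable borel" and bd: "\<And>s. \<bar>\<theta> s\<bar> \<le> M" and \<gamma>: "\<gamma> > 0"
    and asym: "\<And>e. e > 0 \<Longrightarrow> \<exists>d>0. AE s in lborel. 0 < s \<longrightarrow> s < d \<longrightarrow> \<bar>\<theta> s - C * s powr \<gamma>\<bar> \<le> e * s powr \<gamma>"
  shows "((\<lambda>y. (LBINT s:{0..y}. \<theta> s) / y powr (1 + \<gamma>)) \<longlongrightarrow> C / (1 + \<gamma>)) (at_right 0)"
  unfolding tendsto_iff
proof (intro allI impI)
  fix e :: real assume "e > 0"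
  define \<epsilon> where "\<epsilon> = e / 2"
  have \<epsilon>: "\<epsilon> > 0" "\<epsilon> < e" using \<open>e > 0\<close> by (simp_all add: \<epsilon>_def)
  obtain d where d: "d > 0"
    and ae: "AE s in lborel. 0 < s \<longrightarrow> s < d \<longrightarrow> \<bar>\<theta> s - C * s powr \<gamma>\<bar> \<le> \<epsilon> * s powr \<gamma>"
    using asym[OF \<epsilon>(1)] by auto
  have "dist ((LBINT s:{0..y}. \<theta> s) / y powr (1 + \<gamma>)) (C / (1 + \<gamma>)) < e" if y: "0 < y" "y < d" for y
  proof -
    define P where "P = y powr (1 + \<gamma>) / (1 + \<gamma>)"
    have P: "P > 0" using y \<gamma> by (simp add: P_def)
    have int: "set_integrable lborel {0..y} (\<lambda>s. a * s powr \<gamma>)"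
      "(LBINT s:{0..y}. a * s powr \<gamma>) = a * P" for a
      using set_integral_powr_from_0[of \<gamma> y] \<gamma> y by (simp_all add: P_def)
    have "AE s in lborel. s \<noteq> (0::real)" by (rule AE_lborel_singleton)
    with ae have near: "AE s in lborel. s \<in> {0..y} \<longrightarrow> \<bar>\<theta> s - C * s powr \<gamma>\<bar> \<le> \<epsilon> * s powr \<gamma>"
      by eventually_elim (use y in auto)
    have "(LBINT s:{0..y}. \<theta> s) \<le> (LBINT s:{0..y}. (C + \<epsilon>) * s powr \<gamma>)"
    proof (rule set_integral_mono_AE[OF set_integrable_bounded_Icc[OF m bd] int(1)])
      show "AE s\<in>{0..y} in lborel. \<theta> s \<le> (C + \<epsilon>) * s powr \<gamma>"
        using near by eventually_elim (auto dest!: abs_le_D1 simp: distrib_right)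
    qed
    moreover have "(LBINT s:{0..y}. (C - \<epsilon>) * s powr \<gamma>) \<le> (LBINT s:{0..y}. \<theta> s)"
    proof (rule set_integral_mono_AE[OF int(1) set_integrable_bounded_Icc[OF m bd]])
      show "AE s\<in>{0..y} in lborel. (C - \<epsilon>) * s powr \<gamma> \<le> \<theta> s"
        using near by eventually_elim (auto dest!: abs_le_D2 simp: left_diff_distrib)
    qed
    ultimately have "\<bar>(LBINT s:{0..y}. \<theta> s) - C * P\<bar> \<le> \<epsilon> * P"
      unfolding int(2) by (simp add: abs_le_iff algebra_simps)
    moreover have "(LBINT s:{0..y}. \<theta> s) / y powr (1 + \<gamma>) - C / (1 + \<gamma>)
        = ((LBINT s:{0..y}. \<theta> s) - C * P) / y powr (1 + \<gamma>)"
      using y by (simp add: P_def diff_divide_distrib)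
    ultimately have "\<bar>(LBINT s:{0..y}. \<theta> s) / y powr (1 + \<gamma>) - C / (1 + \<gamma>)\<bar> \<le> \<epsilon> * P / y powr (1 + \<gamma>)"
      using y by (simp add: divide_right_mono)
    also have "\<dots> = \<epsilon> / (1 + \<gamma>)" using y by (simp add: P_def)
    also have "\<dots> \<le> \<epsilon> / 1" using \<epsilon> \<gamma> by (intro divide_left_mono) auto
    also have "\<dots> < e" using \<epsilon> by simp
    finally show ?thesis by (simp add: dist_real_def)
  qed
  then show "\<forall>\<^sub>F y in at_right 0. dist ((LBINT s:{0..y}. \<theta> s) / y powr (1 + \<gamma>)) (C / (1 + \<gamma>)) < e"
    using d by (auto simp: eventually_at_right[of 0 d])
qed

text \<open>The side of \<open>x\<^sub>0\<close> is encoded by \<open>\<sigma> = \<plusminus>1\<close>: displacements \<open>l = - \<sigma> y\<close> with \<open>y > 0\<close> correspond to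
  states \<open>u = c + \<sigma> h\<close> with \<open>h > 0\<close>.\<close>

definition side :: "real \<Rightarrow> real \<Rightarrow> real filter" where
  "side \<sigma> a = filtermap (\<lambda>h. a + \<sigma> * h) (at_right 0)"

lemma side_simps: "side 1 a = at_right a" "side (- 1) a = at_left a"
proof -
  show "side 1 a = at_right a"
    unfolding side_def by (subst at_right_to_0) (simp add: add.commute)
  show "side (- 1) a = at_left a"
    unfolding side_def by (subst at_left_minus, subst at_right_to_0) (simp add: filtermap_filtermap)
qed

section \<open>One-sided power asymptotics of the speed and of the Bregman distance\<close>

context convex_flux
begin

lemma flux_asymp_limit:
  assumes fa: "flux_asymp (side \<sigma> c) f c \<alpha> N" and \<sigma>: "\<bar>\<sigma>\<bar> = 1"
  shows "((\<lambda>h. k (c + \<sigma> * h) / h powr \<alpha>) \<longlongrightarrow> N) (at_right 0)"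
proof -
  have pos: "\<forall>\<^sub>F h in at_right 0. h > (0::real)" by (simp add: eventually_at_right_less)
  have "((\<lambda>h. (k (c + \<sigma> * h) - N * h powr \<alpha>) / h powr \<alpha>) \<longlongrightarrow> 0) (at_right 0)"
  proof -
    have "((\<lambda>u. (k u - N * \<bar>u - c\<bar> powr \<alpha>) / \<bar>u - c\<bar> powr \<alpha>) \<longlongrightarrow> 0) (side \<sigma> c)"
      using fa unfolding flux_asymp_def by (rule smalloD_tendsto)
    then have "((\<lambda>h. (k (c + \<sigma> * h) - N * \<bar>\<sigma> * h\<bar> powr \<alpha>) / \<bar>\<sigma> * h\<bar> powr \<alpha>) \<longlongrightarrow> 0) (at_right 0)"
      by (simp add: side_def filterlim_filtermap)
    then show ?thesis
      by (rule Lim_transform_eventually) (use pos \<sigma> in \<open>auto elim!: eventually_mono simp: abs_mult\<close>)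
  qed
  then have "((\<lambda>h. (k (c + \<sigma> * h) - N * h powr \<alpha>) / h powr \<alpha> + N) \<longlongrightarrow> 0 + N) (at_right 0)"
    by (intro tendsto_intros)
  then have "((\<lambda>h. (k (c + \<sigma> * h) - N * h powr \<alpha>) / h powr \<alpha> + N) \<longlongrightarrow> N) (at_right 0)" by simp
  then show ?thesis
  proof (rule Lim_transform_eventually)
    show "\<forall>\<^sub>F h in at_right 0. (k (c + \<sigma> * h) - N * h powr \<alpha>) / h powr \<alpha> + N = k (c + \<sigma> * h) / h powr \<alpha>"
      using pos by eventually_elim (simp add: diff_divide_distrib)
  qed
qed

lemma powr_lhopital:
  assumes lim: "((\<lambda>h. p' h / h powr \<beta>) \<longlongrightarrow> N) (at_right 0)" and \<beta>: "\<beta> \<ge> 0"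
    and d: "\<And>h. (p has_real_derivative p' h) (at h)" and "p 0 = 0"
  shows "((\<lambda>h. p h / h powr (1 + \<beta>)) \<longlongrightarrow> N / (1 + \<beta>)) (at_right 0)"
proof (rule lhopital_right_0[where f' = p' and g' = "\<lambda>h. (1 + \<beta>) * h powr \<beta>"])
  have pos: "\<forall>\<^sub>F h in at_right 0. h > (0::real)" by (simp add: eventually_at_right_less)
  have "(p \<longlongrightarrow> p 0) (at 0)" using DERIV_isCont[OF d] by (simp add: isCont_def)
  then show "(p \<longlongrightarrow> 0) (at_right 0)" using \<open>p 0 = 0\<close> by (auto intro: tendsto_within_subset)
  have "((\<lambda>h::real. h powr (1 + \<beta>)) \<longlongrightarrow> 0 powr (1 + \<beta>)) (at_right 0)"
    using \<beta> pos by (intro tendsto_powr' tendsto_intros) (auto elim: eventually_mono)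
  then show "((\<lambda>h::real. h powr (1 + \<beta>)) \<longlongrightarrow> 0) (at_right 0)" by simp
  show "\<forall>\<^sub>F h in at_right 0. h powr (1 + \<beta>) \<noteq> 0" using pos by eventually_elim simp
  show "\<forall>\<^sub>F h in at_right 0. (1 + \<beta>) * h powr \<beta> \<noteq> 0" using pos by eventually_elim (use \<beta> in simp)
  show "\<forall>\<^sub>F h in at_right 0. (p has_real_derivative p' h) (at h)" using d by simp
  show "\<forall>\<^sub>F h in at_right 0. ((\<lambda>h. h powr (1 + \<beta>)) has_real_derivative (1 + \<beta>) * h powr \<beta>) (at h)"
    using pos by eventually_elim (auto intro!: derivative_eq_intros simp: powr_diff)
  have "((\<lambda>h. p' h / h powr \<beta> / (1 + \<beta>)) \<longlongrightarrow> N / (1 + \<beta>)) (at_right 0)"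
    using \<beta> by (intro tendsto_intros lim) auto
  then show "((\<lambda>h. p' h / ((1 + \<beta>) * h powr \<beta>)) \<longlongrightarrow> N / (1 + \<beta>)) (at_right 0)"
    by (simp add: mult.commute)
qed

lemma speed_asymptotics:
  assumes fa: "flux_asymp (side \<sigma> c) f c \<alpha> N" and \<sigma>: "\<bar>\<sigma>\<bar> = 1" and \<alpha>: "\<alpha> \<ge> 0"
  shows "((\<lambda>h. \<sigma> * (g (c + \<sigma> * h) - g c) / h powr (1 + \<alpha>)) \<longlongrightarrow> N / (1 + \<alpha>)) (at_right 0)"
proof (rule powr_lhopital[OF flux_asymp_limit[OF fa \<sigma>] \<alpha>])
  fix h
  have "((\<lambda>h. \<sigma> * (g (c + \<sigma> * h) - g c)) has_real_derivative \<sigma> * (k (c + \<sigma> * h) * \<sigma>)) (at h)"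
    by (auto intro!: derivative_eq_intros DERIV_chain2[OF g_deriv])
  also have "\<sigma> * (k (c + \<sigma> * h) * \<sigma>) = k (c + \<sigma> * h)" using \<sigma> by (auto simp: abs_if split: if_splits)
  finally show "((\<lambda>h. \<sigma> * (g (c + \<sigma> * h) - g c)) has_real_derivative k (c + \<sigma> * h)) (at h)" .
qed simp

text \<open>Along \<open>c + \<sigma> * h\<close> the Bregman distance has derivative
  \<open>h * k (c + \<sigma> * h)\<close>, because \<sigma> squared is one; this is of order
  \<open>1 + \<alpha>\<close>, and L'Hopital's rule raises the order by one.\<close>

lemma breg_asymptotics:
  assumes fa: "flux_asymp (side \<sigma> c) f c \<alpha> N" and \<sigma>: "\<bar>\<sigma>\<bar> = 1" and \<alpha>: "\<alpha> \<ge> 0"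
  shows "((\<lambda>h. breg (c + \<sigma> * h) c / h powr (2 + \<alpha>)) \<longlongrightarrow> N / (2 + \<alpha>)) (at_right 0)"
proof -
  have pos: "\<forall>\<^sub>F h in at_right 0. h > (0::real)" by (simp add: eventually_at_right_less)
  have "((\<lambda>h. breg (c + \<sigma> * h) c / h powr (1 + (1 + \<alpha>))) \<longlongrightarrow> N / (1 + (1 + \<alpha>))) (at_right 0)"
  proof (rule powr_lhopital[where p' = "\<lambda>h. h * k (c + \<sigma> * h)"])
    show "((\<lambda>h. h * k (c + \<sigma> * h) / h powr (1 + \<alpha>)) \<longlongrightarrow> N) (at_right 0)"
      using flux_asymp_limit[OF fa \<sigma>]
    proof (rule Lim_transform_eventually)
      show "\<forall>\<^sub>F h in at_right 0. k (c + \<sigma> * h) / h powr \<alpha> = h * k (c + \<sigma> * h) / h powr (1 + \<alpha>)"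
        using pos by eventually_elim (simp add: powr_add)
    qed
    fix h
    have "((\<lambda>h. breg (c + \<sigma> * h) c) has_real_derivative ((c + \<sigma> * h - c) * k (c + \<sigma> * h)) * \<sigma>) (at h)"
      by (rule DERIV_chain2[OF breg_deriv]) (auto intro!: derivative_eq_intros)
    also have "((c + \<sigma> * h - c) * k (c + \<sigma> * h)) * \<sigma> = h * k (c + \<sigma> * h)"
      using \<sigma> by (auto simp: abs_if split: if_splits)
    finally show "((\<lambda>h. breg (c + \<sigma> * h) c) has_real_derivative h * k (c + \<sigma> * h)) (at h)" .
  qed (use \<alpha> in auto)
  then show ?thesis by (simp add: add.assoc[symmetric])
qed

end

section \<open>Asymptotics of the data and the one-sided values of \<open>tp\<close>\<close>

context convex_flux_data
begin

lemma Phi_loc_asymptotics: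
  assumes da: "data_asymp (side (- \<sigma>) 0) \<phi> x0 c \<gamma> C" and \<sigma>: "\<sigma> = 1 \<or> \<sigma> = -1" and \<gamma>: "\<gamma> > 0"
  shows "((\<lambda>y. Phi_loc \<phi> (- \<sigma> * y) x0 c / y powr (1 + \<gamma>)) \<longlongrightarrow> C / (1 + \<gamma>)) (at_right 0)"
proof -
  obtain \<psi> M where p: "\<psi> \<in> borel_measurable borel" "\<And>x. \<bar>\<psi> x\<bar> \<le> M" "0 \<le> M" "AE x in lborel. \<phi> x = \<psi> x"
    using Linfty_fun_borel_representative[OF Linfty] by metis
  note [measurable] = p(1)
  \<comment> \<open>The sign and the reflection are chosen so that the integral of \<theta> over
    \<open>{0..y}\<close> is \<open>Phi_loc\<close> at \<open>- \<sigma> * y\<close>, while \<theta>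
    behaves like \<open>C * s powr \<gamma>\<close> on either side.\<close>
  define \<theta> where "\<theta> = (\<lambda>s. - \<sigma> * (\<psi> (x0 - \<sigma> * s) - c))"
  have \<theta>m: "\<theta> \<in> borel_measurable borel" unfolding \<theta>_def by measurable
  have \<theta>b: "\<bar>\<theta> s\<bar> \<le> M + \<bar>c\<bar>" for s
    using p(2)[of "x0 - \<sigma> * s"] \<sigma> by (auto simp: \<theta>_def abs_le_iff abs_if split: if_splits)
  \<comment> \<open>Affine maps of slope 1 or -1 preserve \<open>lborel\<close>, so they carry
    almost everywhere statements along.\<close>
  have affine: "AE s in lborel. P (x0 - \<sigma> * s)" if "AE x in lborel. P x" for P
  proof -
    have "AE s in lborel. P (x0 + (- \<sigma>) * s)"
    proof -
      have "lborel = density (distr lborel borel (\<lambda>x. x0 + (- \<sigma>) * x)) (\<lambda>_. ennreal \<bar>- \<sigma>\<bar>)"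
        using \<sigma> by (intro lborel_real_affine) auto
      also have "\<dots> = distr lborel borel (\<lambda>x. x0 + (- \<sigma>) * x)" using \<sigma> by (auto simp: density_1)
      finally have eq: "lborel = distr lborel borel (\<lambda>x. x0 + (- \<sigma>) * x)" .
      from that have "AE x in distr lborel borel (\<lambda>x. x0 + (- \<sigma>) * x). P x" by (subst eq[symmetric])
      then show ?thesis by (rule AE_distrD[rotated]) measurable
    qed
    then show ?thesis by simp
  qed
  have "\<exists>d>0. AE s in lborel. 0 < s \<longrightarrow> s < d \<longrightarrow> \<bar>\<theta> s - C * s powr \<gamma>\<bar> \<le> e * s powr \<gamma>" if "e > 0" for e
  proof -
    have "\<forall>\<^sub>F l in inf (side (- \<sigma>) 0) (ae_filter lebesgue).
        norm (\<phi> (x0 + l) - c - C * sgn l * \<bar>l\<bar> powr \<gamma>) \<le> e * norm (sgn l * \<bar>l\<bar> powr \<gamma>)"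
      using landau_o.smallD[OF da[unfolded data_asymp_def] that] .
    then obtain Q R where Q: "eventually Q (side (- \<sigma>) 0)" and R: "AE l in lebesgue. R l"
      and QR: "\<And>l. Q l \<Longrightarrow> R l \<Longrightarrow>
        norm (\<phi> (x0 + l) - c - C * sgn l * \<bar>l\<bar> powr \<gamma>) \<le> e * norm (sgn l * \<bar>l\<bar> powr \<gamma>)"
      unfolding eventually_inf by blast
    obtain d where d: "d > 0" "\<And>h. 0 < h \<Longrightarrow> h < d \<Longrightarrow> Q (- \<sigma> * h)"
      using Q by (auto simp: side_def eventually_filtermap eventually_at_right[of 0 1])
    \<comment> \<open>\<open>R\<close> speaks of displacements; moved to positions \<open>x\<close>,
      it can be pulled back by \<open>affine\<close> together with the equality of \<phi> and
      \<psi>.\<close>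
    have R': "AE x in lborel. R (x - x0)"
    proof -
      have "AE l in lborel. R l" using R by (simp add: AE_completion_iff)
      moreover have "lborel = distr lborel borel (\<lambda>x. - x0 + x)"
        by (rule lborel_distr_plus[symmetric])
      ultimately have "AE x in distr lborel borel (\<lambda>x. - x0 + x). R x" by metis
      then have "AE x in lborel. R (- x0 + x)" by (rule AE_distrD[rotated]) measurable
      then show ?thesis by simp
    qed
    have "AE s in lborel. R (- \<sigma> * s) \<and> \<phi> (x0 - \<sigma> * s) = \<psi> (x0 - \<sigma> * s)"
      using affine[OF AE_conjI[OF R' p(4)]] by simp
    then have "AE s in lborel. 0 < s \<longrightarrow> s < d \<longrightarrow> \<bar>\<theta> s - C * s powr \<gamma>\<bar> \<le> e * s powr \<gamma>"
    proof eventually_elim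
      case (elim s)
      show ?case
      proof (intro impI)
        assume s: "0 < s" "s < d"
        have "norm (\<phi> (x0 + - \<sigma> * s) - c - C * sgn (- \<sigma> * s) * \<bar>- \<sigma> * s\<bar> powr \<gamma>)
            \<le> e * norm (sgn (- \<sigma> * s) * \<bar>- \<sigma> * s\<bar> powr \<gamma>)"
          using elim d(2)[OF s] by (intro QR) auto
        then show "\<bar>\<theta> s - C * s powr \<gamma>\<bar> \<le> e * s powr \<gamma>"
          using \<sigma> s elim by (auto simp: \<theta>_def abs_le_iff algebra_simps)
      qed
    qed
    with d(1) show ?thesis by blast
  qed
  then have lim: "((\<lambda>y. (LBINT s:{0..y}. \<theta> s) / y powr (1 + \<gamma>)) \<longlongrightarrow> C / (1 + \<gamma>)) (at_right 0)"
    by (intro integral_power_asymptotics[OF \<theta>m \<theta>b \<gamma>])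
  have "Phi_loc \<phi> (- \<sigma> * y) x0 c = (LBINT s:{0..y}. \<theta> s)" if y: "y > 0" for y
  proof -
    have 1: "Phi_loc \<phi> (- \<sigma> * y) x0 c = (LBINT x=x0..x0 + - \<sigma> * y. \<psi> x - c)"
      unfolding Phi_loc_def
      using p by (intro interval_lebesgue_integral_lebesgue_cong_AE_lborel) (auto elim: eventually_mono)
    show ?thesis
    proof (cases "\<sigma> = 1")
      case True
      have "(LBINT x=x0..x0 + - \<sigma> * y. \<psi> x - c) = - (LBINT x:{x0 - y..x0}. \<psi> x - c)"
        using True y by (subst interval_integral_endpoints_reverse) (simp add: interval_integral_Icc)
      also have "(LBINT x:{x0 - y..x0}. \<psi> x - c) = (LBINT s:{0..y}. \<psi> (x0 - s) - c)"
        unfolding set_lebesgue_integral_def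
        by (subst lborel_integral_real_affine[of "-1" _ x0])
           (auto intro!: Bochner_Integration.integral_cong simp: indicator_def)
      also have "- \<dots> = (LBINT s:{0..y}. \<theta> s)"
        unfolding \<theta>_def using True by (simp add: set_lebesgue_integral_def algebra_simps flip: integral_minus)
      finally show ?thesis using 1 by simp
    next
      case False
      then have s: "\<sigma> = -1" using \<sigma> by simp
      have "(LBINT x=x0..x0 + - \<sigma> * y. \<psi> x - c) = (LBINT x:{x0..x0 + y}. \<psi> x - c)"
        using s y by (simp add: interval_integral_Icc)
      also have "\<dots> = (LBINT s:{0..y}. \<psi> (x0 + s) - c)"
        unfolding set_lebesgue_integral_def
        by (subst lborel_integral_real_affine[of 1 _ x0])
           (auto intro!: Bochner_Integration.integral_cong simp: indicator_def)
      also have "\<dots> = (LBINT s:{0..y}. \<theta> s)" using s by (simp add: \<theta>_def)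
      finally show ?thesis using 1 by simp
    qed
  qed
  then have "\<forall>\<^sub>F y in at_right 0. (LBINT s:{0..y}. \<theta> s) / y powr (1 + \<gamma>) = Phi_loc \<phi> (- \<sigma> * y) x0 c / y powr (1 + \<gamma>)"
    using eventually_at_right_less[of "0::real"] by (auto elim!: eventually_mono)
  with lim show ?thesis by (rule Lim_transform_eventually)
qed

text \<open>Displacements are parametrized by the increment \<open>h\<close> of the state, which
  removes the inverse of \<open>g\<close> hidden in \<open>F_loc\<close>.\<close>

lemma adm_side_iff:
  assumes t: "t > 0" and \<sigma>: "\<sigma> = 1 \<or> \<sigma> = -1"
  shows "t \<in> adm x0 c (side (- \<sigma>) 0) \<longleftrightarrow>
    (\<forall>\<^sub>F h in at_right 0. Phi_loc \<phi> (- \<sigma> * (t * (\<sigma> * (g (c + \<sigma> * h) - g c)))) x0 c > - t * breg (c + \<sigma> * h) c)"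
    (is "?L \<longleftrightarrow> (\<forall>\<^sub>F h in at_right 0. ?P h)")
proof -
  let ?m = "\<lambda>h. t * (\<sigma> * (g (c + \<sigma> * h) - g c))"
  have F: "F_loc f (- \<sigma> * ?m h) t c = - t * breg (c + \<sigma> * h) c" for h
  proof -
    have "- \<sigma> * ?m h = t * (g c - g (c + \<sigma> * h))" using \<sigma> by (auto simp: algebra_simps)
    then show ?thesis using u_loc_eq[OF t] by (simp only: F_loc_eq)
  qed
  have "?L \<longleftrightarrow> (\<forall>\<^sub>F y in at_right 0. Phi_loc \<phi> (- \<sigma> * y) x0 c > F_loc f (- \<sigma> * y) t c)"
    using t by (simp add: adm_def side_def eventually_filtermap)
  also have "\<dots> \<longleftrightarrow> (\<forall>\<^sub>F h in at_right 0. Phi_loc \<phi> (- \<sigma> * ?m h) x0 c > F_loc f (- \<sigma> * ?m h) t c)"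
  proof (rule eventually_at_right_0_strict_mono_iff)
    show "continuous_on UNIV ?m"
      by (intro continuous_intros continuous_on_compose2[OF g_cont[of UNIV]]) auto
    show "?m x < ?m y" if "x < y" for x y
      using t \<sigma> that by (auto simp: g_less_iff)
  qed simp
  also have "\<dots> \<longleftrightarrow> (\<forall>\<^sub>F h in at_right 0. ?P h)" unfolding F ..
  finally show ?thesis .
qed

lemma Sup_adm_top: "(\<And>t. t > 0 \<Longrightarrow> t \<in> adm x0 c F) \<Longrightarrow> Sup (ereal ` adm x0 c F) = \<infinity>"
proof -
  assume all: "\<And>t. t > 0 \<Longrightarrow> t \<in> adm x0 c F"
  have "ereal r \<le> Sup (ereal ` adm x0 c F)" for r
  proof -
    have "ereal r \<le> ereal (max r 1)" by simp
    also have "\<dots> \<le> Sup (ereal ` adm x0 c F)" by (intro Sup_upper imageI all) simp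
    finally show ?thesis .
  qed
  then show ?thesis by (rule ereal_top)
qed

text \<open>The ratio of the two sides of the defining inequality of \<open>t\<^sub>p\<close> behaves like a constant
  times \<open>h\<close> to the power \<open>\<gamma> (1 + \<alpha>) - 1\<close>; for vanishing exponent the constant crosses \<open>-1\<close> exactly
  at the claimed time.\<close>

lemma adm_asymptotics:
  fixes \<sigma> \<alpha> N \<gamma> C x0 c :: real
  defines "S \<equiv> Sup (ereal ` adm x0 c (side (- \<sigma>) 0))"
  assumes \<sigma>: "\<sigma> = 1 \<or> \<sigma> = -1" and \<alpha>: "\<alpha> \<ge> 0" and \<gamma>: "\<gamma> > 0" and N: "N > 0" and C: "C \<noteq> 0"
    and fa: "flux_asymp (side \<sigma> c) f c \<alpha> N" and da: "data_asymp (side (- \<sigma>) 0) \<phi> x0 c \<gamma> C"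
  shows "0 < S \<and> S < \<infinity> \<longleftrightarrow> C < 0 \<and> \<gamma> * (1 + \<alpha>) = 1"
    and "0 < S \<and> S < \<infinity> \<Longrightarrow> S = ereal (inverse (\<gamma> * N * \<bar>C\<bar> powr (1 + \<alpha>)))"
proof -
  define p where "p = (\<lambda>h. \<sigma> * (g (c + \<sigma> * h) - g c))"
  define q where "q = (\<lambda>h. breg (c + \<sigma> * h) c)"
  \<comment> \<open>The exponent left over when the order
    \<open>(1 + \<alpha>) * (1 + \<gamma>)\<close> of \<open>Phi_loc\<close> is compared with the
    order \<open>2 + \<alpha>\<close> of the Bregman distance.\<close>
  define e where "e = \<gamma> * (1 + \<alpha>) - 1"
  have \<sigma>': "\<bar>\<sigma>\<bar> = 1" using \<sigma> by auto
  have adm: "t \<in> adm x0 c (side (- \<sigma>) 0) \<longleftrightarrow>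
      (\<forall>\<^sub>F h in at_right 0. Phi_loc \<phi> (- \<sigma> * (t * p h)) x0 c > - t * q h)" if "t > 0" for t
    using adm_side_iff[OF that \<sigma>] by (simp add: p_def q_def)
  have pos: "\<forall>\<^sub>F h in at_right 0. h > (0::real)" by (simp add: eventually_at_right_less)
  have p_pos: "p h > 0" and q_pos: "q h > 0" if "h > 0" for h
  proof -
    show "p h > 0" using that \<sigma> by (auto simp: p_def g_less_iff)
    show "q h > 0" using that \<sigma> by (auto simp: q_def intro!: breg_pos)
  qed
  have plim: "((\<lambda>h. p h / h powr (1 + \<alpha>)) \<longlongrightarrow> N / (1 + \<alpha>)) (at_right 0)"
    unfolding p_def by (rule speed_asymptotics[OF fa \<sigma>' \<alpha>])
  have qlim: "((\<lambda>h. q h / h powr (2 + \<alpha>)) \<longlongrightarrow> N / (2 + \<alpha>)) (at_right 0)"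
    unfolding q_def by (rule breg_asymptotics[OF fa \<sigma>' \<alpha>])
  have p0: "(p \<longlongrightarrow> 0) (at_right 0)"
  proof -
    have "((\<lambda>h. c + \<sigma> * h) \<longlongrightarrow> c) (at_right 0)" by (auto intro!: tendsto_eq_intros)
    from isCont_tendsto_compose[OF g_isCont this] show ?thesis
      unfolding p_def by (auto intro!: tendsto_eq_intros)
  qed
  define X where "X = (\<lambda>t h. Phi_loc \<phi> (- \<sigma> * (t * p h)) x0 c / (t * p h) powr (1 + \<gamma>))"
  have X: "(X t \<longlongrightarrow> C / (1 + \<gamma>)) (at_right 0)" if t: "t > 0" for t
  proof -
    have "((\<lambda>h. t * p h) \<longlongrightarrow> 0) (at_right 0)" using p0 by (auto intro!: tendsto_eq_intros)
    moreover have "\<forall>\<^sub>F h in at_right 0. t * p h \<in> {0<..} \<and> t * p h \<noteq> 0"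
      using pos by eventually_elim (use p_pos t in force)
    ultimately have "filterlim (\<lambda>h. t * p h) (at_right 0) (at_right 0)" by (simp add: filterlim_at)
    from filterlim_compose[OF Phi_loc_asymptotics[OF da \<sigma> \<gamma>] this] show ?thesis
      by (simp add: X_def)
  qed
  \<comment> \<open>\<open>Z t h * h powr e\<close> is the quotient of \<open>Phi_loc\<close> by
    \<open>t * q h\<close>. The factor \<open>Z t\<close> has the finite nonzero limit
    \<open>z t\<close>, with the sign of \<open>C\<close>, so admissibility of \<open>t\<close>
    depends on how this product compares with -1.\<close>
  define Z where "Z = (\<lambda>t h. X t h * (t powr \<gamma> * (p h / h powr (1 + \<alpha>)) powr (1 + \<gamma>) / (q h / h powr (2 + \<alpha>))))"
  define z where "z = (\<lambda>t. C / (1 + \<gamma>) * (t powr \<gamma> * (N / (1 + \<alpha>)) powr (1 + \<gamma>) / (N / (2 + \<alpha>))))"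
  have Z: "(Z t \<longlongrightarrow> z t) (at_right 0)" if "t > 0" for t
    unfolding Z_def z_def using N \<alpha> by (intro tendsto_intros X[OF that] plim qlim) auto
  have ratio: "Phi_loc \<phi> (- \<sigma> * (t * p h)) x0 c = t * q h * (Z t h * h powr e)" if t: "t > 0" and h: "h > 0" for t h
  proof -
    have ph: "p h > 0" and qh: "q h > 0" using p_pos q_pos h by auto
    define W where "W = (p h / h powr (1 + \<alpha>)) powr (1 + \<gamma>)"
    have "h powr e * h powr (2 + \<alpha>) = h powr ((1 + \<alpha>) * (1 + \<gamma>))"
      by (simp add: powr_add[symmetric] e_def algebra_simps)
    then have W: "W * (h powr e * h powr (2 + \<alpha>)) = p h powr (1 + \<gamma>)"
      using ph h by (simp add: W_def powr_divide powr_powr)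
    have "t * q h * (Z t h * h powr e) = X t h * t * t powr \<gamma> * (W * (h powr e * h powr (2 + \<alpha>)))"
      using qh h unfolding Z_def W_def[symmetric] by simp
    also have "\<dots> = X t h * (t * p h) powr (1 + \<gamma>)"
      using t ph unfolding W by (simp add: powr_mult powr_add)
    also have "\<dots> = Phi_loc \<phi> (- \<sigma> * (t * p h)) x0 c"
      using t ph by (simp add: X_def)
    finally show ?thesis by simp
  qed
  have adm': "t \<in> adm x0 c (side (- \<sigma>) 0) \<longleftrightarrow> (\<forall>\<^sub>F h in at_right 0. Z t h * h powr e > -1)" if t: "t > 0" for t
    unfolding adm[OF t]
  proof (rule eventually_cong[OF pos])
    fix h :: real assume h: "h > 0"
    then have "t * q h > 0" using t q_pos by simp
    then show "- t * q h < Phi_loc \<phi> (- \<sigma> * (t * p h)) x0 c \<longleftrightarrow> - 1 < Z t h * h powr e"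
      unfolding ratio[OF t h]
      using mult_less_cancel_left_pos[of "t * q h" "-1" "Z t h * h powr e"] by simp
  qed
  have z_sgn: "z t < 0 \<longleftrightarrow> C < 0" "z t > 0 \<longleftrightarrow> C > 0" if "t > 0" for t
    using that \<gamma> \<alpha> N by (simp_all add: z_def zero_less_mult_iff mult_less_0_iff zero_less_divide_iff divide_less_0_iff)
  show "0 < S \<and> S < \<infinity> \<longleftrightarrow> C < 0 \<and> \<gamma> * (1 + \<alpha>) = 1"
    and "0 < S \<and> S < \<infinity> \<Longrightarrow> S = ereal (inverse (\<gamma> * N * \<bar>C\<bar> powr (1 + \<alpha>)))"
  proof -
    consider (pos) "C > 0" | (high) "C < 0" "e > 0" | (low) "C < 0" "e < 0" | (crit) "C < 0" "e = 0"
      using C by fastforce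
    then have "(0 < S \<and> S < \<infinity> \<longleftrightarrow> C < 0 \<and> \<gamma> * (1 + \<alpha>) = 1)
      \<and> (0 < S \<and> S < \<infinity> \<longrightarrow> S = ereal (inverse (\<gamma> * N * \<bar>C\<bar> powr (1 + \<alpha>))))"
    proof cases
      case pos
      have "t \<in> adm x0 c (side (- \<sigma>) 0)" if t: "t > 0" for t
      proof -
        have "\<forall>\<^sub>F h in at_right 0. Z t h > 0" using order_tendstoD(1)[OF Z[OF t]] z_sgn[OF t] pos by auto
        then have "\<forall>\<^sub>F h in at_right 0. Z t h * h powr e > -1"
          by eventually_elim (simp add: less_le_trans[of "-1" 0])
        then show ?thesis by (simp add: adm'[OF t])
      qed
      then have "S = \<infinity>" unfolding S_def by (rule Sup_adm_top)
      with pos show ?thesis by simp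
    next
      case high
      have e0: "((\<lambda>h::real. h powr e) \<longlongrightarrow> 0) (at_right 0)"
      proof -
        have "((\<lambda>h::real. h powr e) \<longlongrightarrow> 0 powr e) (at_right 0)"
          using high pos by (intro tendsto_powr' tendsto_intros) (auto elim: eventually_mono)
        then show ?thesis by simp
      qed
      have "t \<in> adm x0 c (side (- \<sigma>) 0)" if t: "t > 0" for t
      proof -
        have "((\<lambda>h. Z t h * h powr e) \<longlongrightarrow> z t * 0) (at_right 0)" by (intro tendsto_intros Z[OF t] e0)
        then have "\<forall>\<^sub>F h in at_right 0. Z t h * h powr e > -1" by (rule order_tendstoD(1)) simp
        then show ?thesis by (simp add: adm'[OF t])
      qed
      then have "S = \<infinity>" unfolding S_def by (rule Sup_adm_top)
      with high show ?thesis by (simp add: e_def)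
    next
      case low
      have etop: "LIM h at_right 0. h powr e :> at_top"
      proof -
        have "((\<lambda>h::real. h powr (- e)) \<longlongrightarrow> 0 powr (- e)) (at_right 0)"
          using low pos by (intro tendsto_powr' tendsto_intros) (auto elim: eventually_mono)
        then have "LIM h at_right (0::real). inverse (h powr (- e)) :> at_top"
          using pos by (intro filterlim_inverse_at_top) (auto elim: eventually_mono)
        then show ?thesis by (simp add: powr_minus)
      qed
      have "t \<notin> adm x0 c (side (- \<sigma>) 0)" if t: "t > 0" for t
      proof
        assume "t \<in> adm x0 c (side (- \<sigma>) 0)"
        then have "\<forall>\<^sub>F h in at_right 0. Z t h * h powr e > -1" by (simp add: adm'[OF t])
        moreover have "LIM h at_right 0. Z t h * h powr e :> at_bot"
          using z_sgn[OF t] low by (intro filterlim_tendsto_neg_mult_at_bot[OF Z[OF t] _ etop]) auto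
        then have "\<forall>\<^sub>F h in at_right 0. Z t h * h powr e \<le> -1" by (simp add: filterlim_at_bot)
        ultimately have "\<forall>\<^sub>F h in at_right (0::real). False" by eventually_elim simp
        then show False by simp
      qed
      then have "adm x0 c (side (- \<sigma>) 0) = {}" by (auto simp: adm_def)
      \<comment> \<open>The supremum of the empty set in \<open>ereal\<close> is minus infinity, so
        this case violates \<open>0 < S\<close> rather than \<open>S < \<infinity>\<close>.\<close>
      then have "S = - \<infinity>" unfolding S_def by (simp add: bot_ereal_def)
      with low show ?thesis by (simp add: e_def)
    next
      case crit
      define T where "T = inverse (\<gamma> * N * \<bar>C\<bar> powr (1 + \<alpha>))"
      have T: "T > 0" using \<gamma> N C by (simp add: T_def)
      have \<alpha>\<gamma>: "\<gamma> * (1 + \<alpha>) = 1" using crit(2) by (simp add: e_def)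
      \<comment> \<open>The critical relation gives \<open>1 + \<alpha> = 1 / \<gamma>\<close>,
        which turns all factors into powers with exponent \<gamma>; the limit then passes -1 exactly
        at \<open>t = T\<close>.\<close>
      have z: "z t = - ((t / T) powr \<gamma>)" if t: "t > 0" for t
      proof -
        have a: "1 + \<alpha> = 1 / \<gamma>" "2 + \<alpha> = (1 + \<gamma>) / \<gamma>" using \<alpha>\<gamma> \<gamma> by (simp_all add: field_simps)
        have "z t = C * (t powr \<gamma> * ((\<gamma> * N) powr (1 + \<gamma>) / (\<gamma> * N)))"
        proof -
          have "N / (1 / \<gamma>) = \<gamma> * N" "N / ((1 + \<gamma>) / \<gamma>) = \<gamma> * N / (1 + \<gamma>)" by simp_all
          moreover have "1 + \<gamma> \<noteq> 0" using \<gamma> by simp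
          ultimately show ?thesis unfolding z_def a by (simp add: mult.commute)
        qed
        also have "(\<gamma> * N) powr (1 + \<gamma>) / (\<gamma> * N) = (\<gamma> * N) powr \<gamma>"
          using \<gamma> N by (simp add: powr_add)
        also have "C * (t powr \<gamma> * (\<gamma> * N) powr \<gamma>) = - (t powr \<gamma> * (\<gamma> * N) powr \<gamma> * \<bar>C\<bar>)"
          using crit by simp
        also have "\<bar>C\<bar> = (\<bar>C\<bar> powr (1 + \<alpha>)) powr \<gamma>"
          using \<alpha>\<gamma> C by (simp add: powr_powr mult.commute)
        also have "t powr \<gamma> * (\<gamma> * N) powr \<gamma> * (\<bar>C\<bar> powr (1 + \<alpha>)) powr \<gamma> = (t * (\<gamma> * N) * \<bar>C\<bar> powr (1 + \<alpha>)) powr \<gamma>"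
          using t \<gamma> N by (simp add: powr_mult)
        also have "t * (\<gamma> * N) * \<bar>C\<bar> powr (1 + \<alpha>) = t / T" by (simp add: T_def field_simps)
        finally show ?thesis .
      qed
      have Zlim: "((\<lambda>h. Z t h * h powr e) \<longlongrightarrow> - ((t / T) powr \<gamma>)) (at_right 0)" if t: "t > 0" for t
      proof -
        have "\<forall>\<^sub>F h in at_right 0. Z t h = Z t h * h powr e" using pos by eventually_elim (simp add: crit)
        with Z[OF t] show ?thesis unfolding z[OF t] by (rule Lim_transform_eventually)
      qed
      \<comment> \<open>At \<open>t = T\<close> the limit is -1 and decides nothing; the strict
        comparisons below and above \<open>T\<close> already determine the supremum.\<close>
      have in_adm: "t \<in> adm x0 c (side (- \<sigma>) 0)" if t: "0 < t" "t < T" for t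
      proof -
        have "(t / T) powr \<gamma> < 1 powr \<gamma>" using t \<gamma> T by (intro powr_less_mono2) auto
        then have "- ((t / T) powr \<gamma>) > -1" by simp
        then show ?thesis using order_tendstoD(1)[OF Zlim[OF t(1)]] adm'[OF t(1)] by blast
      qed
      have not_adm: "t \<le> T" if "t \<in> adm x0 c (side (- \<sigma>) 0)" for t
      proof (rule ccontr)
        assume "\<not> t \<le> T"
        then have t: "0 < t" "T < t" using T by auto
        have "1 powr \<gamma> < (t / T) powr \<gamma>" using t \<gamma> T by (intro powr_less_mono2) auto
        then have "- ((t / T) powr \<gamma>) < -1" by simp
        then have "\<forall>\<^sub>F h in at_right 0. Z t h * h powr e < -1" by (rule order_tendstoD(2)[OF Zlim[OF t(1)]])
        moreover have "\<forall>\<^sub>F h in at_right 0. Z t h * h powr e > -1" using that adm'[OF t(1)] by simp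
        ultimately have "\<forall>\<^sub>F h in at_right (0::real). False" by eventually_elim simp
        then show False by simp
      qed
      have "S = ereal T"
      proof (rule antisym)
        show "S \<le> ereal T" unfolding S_def using not_adm by (auto intro!: Sup_least)
        have "ereal t \<le> S" if "0 < t" "t < T" for t
          unfolding S_def using in_adm[OF that] by (intro Sup_upper) auto
        then show "ereal T \<le> S"
        proof -
          assume *: "\<And>t. 0 < t \<Longrightarrow> t < T \<Longrightarrow> ereal t \<le> S"
          show ?thesis
          proof (rule ccontr)
            assume "\<not> ereal T \<le> S"
            then have "max 0 S < ereal T" using T by simp
            then obtain r where r: "max 0 S < ereal r" "ereal r < ereal T" using ereal_dense2 by blast
            then have "0 < r" "r < T" "S < ereal r" by auto
            with *[of r] show False by simp
          qed
        qed
      qed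
      then show ?thesis using T crit \<alpha>\<gamma> by (simp add: T_def)
    qed
    then show "0 < S \<and> S < \<infinity> \<longleftrightarrow> C < 0 \<and> \<gamma> * (1 + \<alpha>) = 1"
      and "0 < S \<and> S < \<infinity> \<Longrightarrow> S = ereal (inverse (\<gamma> * N * \<bar>C\<bar> powr (1 + \<alpha>)))"
      by blast+
  qed
qed

lemma tp_plus_asymptotics:
  assumes "\<alpha> \<ge> 0" "\<gamma> > 0" "N > 0" "C \<noteq> 0"
    and "flux_asymp (at_left c) f c \<alpha> N" "data_asymp (at_right 0) \<phi> x0 c \<gamma> C"
  shows "0 < tp_plus f \<phi> x0 c \<and> tp_plus f \<phi> x0 c < \<infinity> \<longleftrightarrow> C < 0 \<and> \<gamma> * (1 + \<alpha>) = 1"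
    and "0 < tp_plus f \<phi> x0 c \<and> tp_plus f \<phi> x0 c < \<infinity> \<Longrightarrow>
      tp_plus f \<phi> x0 c = ereal (inverse (\<gamma> * N * \<bar>C\<bar> powr (1 + \<alpha>)))"
  using adm_asymptotics[of "-1" \<alpha> \<gamma> N C c x0] assms by (simp_all add: side_simps tp_adm)

lemma tp_minus_asymptotics:
  assumes "\<alpha> \<ge> 0" "\<gamma> > 0" "N > 0" "C \<noteq> 0"
    and "flux_asymp (at_right c) f c \<alpha> N" "data_asymp (at_left 0) \<phi> x0 c \<gamma> C"
  shows "0 < tp_minus f \<phi> x0 c \<and> tp_minus f \<phi> x0 c < \<infinity> \<longleftrightarrow> C < 0 \<and> \<gamma> * (1 + \<alpha>) = 1"
    and "0 < tp_minus f \<phi> x0 c \<and> tp_minus f \<phi> x0 c < \<infinity> \<Longrightarrow>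
      tp_minus f \<phi> x0 c = ereal (inverse (\<gamma> * N * \<bar>C\<bar> powr (1 + \<alpha>)))"
  using adm_asymptotics[of 1 \<alpha> \<gamma> N C c x0] assms by (simp_all add: side_simps tp_adm)

section \<open>Dini derivatives and sides with infinite time\<close>

lemma F_loc_nonpos: "t > 0 \<Longrightarrow> F_loc f l t c \<le> 0"
  using breg_nonneg by (simp add: F_loc_eq)

text \<open>Above the slope \<open>c\<close>, the right difference quotients make
  \<open>Phi_loc\<close> positive for small \<open>l > 0\<close>, while \<open>F_loc\<close> is
  never positive; every time is admissible.\<close>

lemma tp_plus_infinite:
  assumes "ereal c < lower_right_Dini (Phi \<phi>) x0"
  shows "tp_plus f \<phi> x0 c = \<infinity>"
  unfolding tp_adm
proof (rule Sup_adm_top)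
  fix t :: real assume t: "t > 0"
  have "\<forall>\<^sub>F l in at_right 0. ereal c < ereal ((Phi \<phi> (x0 + l) - Phi \<phi> x0) / l)"
    using assms unfolding lower_right_Dini_def by (rule less_LiminfD)
  with eventually_at_right_less[of 0] have "\<forall>\<^sub>F l in at_right 0. Phi_loc \<phi> l x0 c > F_loc f l t c"
  proof eventually_elim
    case (elim l)
    then have "Phi_loc \<phi> l x0 c > 0" by (simp add: Phi_loc_eq[OF Linfty] pos_less_divide_eq)
    with F_loc_nonpos[OF t] show ?case by (rule le_less_trans)
  qed
  with t show "t \<in> adm x0 c (at_right 0)" by (simp add: adm_def)
qed

text \<open>The mirror image: left difference quotients below \<open>c\<close>, multiplied by a
  negative \<open>l\<close>, again give positive \<open>Phi_loc\<close>.\<close>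

lemma tp_minus_infinite:
  assumes "upper_left_Dini (Phi \<phi>) x0 < ereal c"
  shows "tp_minus f \<phi> x0 c = \<infinity>"
  unfolding tp_adm
proof (rule Sup_adm_top)
  fix t :: real assume t: "t > 0"
  have "\<forall>\<^sub>F l in at_left 0. ereal ((Phi \<phi> (x0 + l) - Phi \<phi> x0) / l) < ereal c"
    using assms unfolding upper_left_Dini_def by (rule Limsup_lessD)
  moreover have "\<forall>\<^sub>F l in at_left 0. l < (0::real)" by (auto simp: eventually_at_filter)
  ultimately have "\<forall>\<^sub>F l in at_left 0. Phi_loc \<phi> l x0 c > F_loc f l t c"
  proof eventually_elim
    case (elim l)
    then have "Phi_loc \<phi> l x0 c > 0" by (simp add: Phi_loc_eq[OF Linfty] neg_divide_less_eq)
    with F_loc_nonpos[OF t] show ?case by (rule le_less_trans)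
  qed
  with t show "t \<in> adm x0 c (at_left 0)" by (simp add: adm_def)
qed

section \<open>Continuous shock generation points on characteristics\<close>

lemma char_values_iff: "c \<in> char_values f \<phi> x0 \<longleftrightarrow> (\<exists>t>0. c \<in> U (x0 + t * g c) t)"
  by (auto simp: char_values_def char_line_def)

text \<open>Continuity yields a unique maximizer \<open>c\<close>; the required characteristic is
  the line of speed \<open>g c\<close> traced back from the point to its foot
  \<open>x0\<close>.\<close>

lemma cont_shock_gen_point_on_char:
  assumes "cont_shock_gen_point f \<phi> x t"
  obtains x0 c where "c \<in> char_values f \<phi> x0" "tp f \<phi> x0 c = ereal t" "x = x0 + t * g c"
    "cont_shock_gen_point_of_char f \<phi> x0 c x t"
proof -
  have t: "t > 0" using assms by (simp add: cont_shock_gen_point_def)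
  with assms obtain c where c: "U x t = {c}" by (auto simp: cont_shock_gen_point_def traces_eq_iff)
  define x0 where "x0 = x - t * g c"
  have x: "x = x0 + t * g c" by (simp add: x0_def)
  have cU: "c \<in> U (x0 + t * g c) t" using c x by simp
  show ?thesis
  proof (rule that[of c x0])
    show "c \<in> char_values f \<phi> x0" using cU t by (auto simp: char_values_iff)
    show "tp f \<phi> x0 c = ereal t" using cont_shock_gen_point_iff[OF t cU] assms x by simp
    show "cont_shock_gen_point_of_char f \<phi> x0 c x t"
      using assms cU t x by (simp add: cont_shock_gen_point_of_char_def char_line_def)
  qed (rule x)
qed

text \<open>At the time \<open>tp\<close> the only remaining condition is that \<open>c\<close> be
  the unique maximizer, that is, strictly positive excess for all other states;
  \<open>rho_eq\<close> rewrites this excess in the stated form.\<close>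

lemma cont_shock_gen_point_of_char_iff:
  assumes t: "t > 0" and tp: "tp f \<phi> x0 c = ereal t"
  shows "cont_shock_gen_point_of_char f \<phi> x0 c (x0 + t * g c) t \<longleftrightarrow>
    (\<forall>l. l \<noteq> 0 \<and> (\<exists>u. l = t * (g c - g u)) \<longrightarrow>
      Phi \<phi> (x0 + l) - Phi \<phi> x0 - c * l > (rho f (inv g (g c - l / t)) c - c) * l)"
proof -
  have "cont_shock_gen_point_of_char f \<phi> x0 c (x0 + t * g c) t \<longleftrightarrow> U (x0 + t * g c) t = {c}"
    using t tp cont_shock_gen_point_iff[OF t, of c x0]
    by (auto simp: cont_shock_gen_point_of_char_def char_line_def)
  also have "\<dots> \<longleftrightarrow> (\<forall>u. u \<noteq> c \<longrightarrow> Phi_loc \<phi> (t * (g c - g u)) x0 c > - t * breg u c)"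
    unfolding U_singleton_iff_excess[OF t] by (auto simp: algebra_simps)
  also have "\<dots> \<longleftrightarrow> (\<forall>u. t * (g c - g u) \<noteq> 0 \<longrightarrow> Phi \<phi> (x0 + t * (g c - g u)) - Phi \<phi> x0 - c * (t * (g c - g u))
      > (rho f (inv g (g c - t * (g c - g u) / t)) c - c) * (t * (g c - g u)))"
  proof -
    have "inv g (g c - t * (g c - g u) / t) = u" for u using t by (simp add: inv_g)
    then show ?thesis using t by (simp add: rho_eq Phi_loc_eq[OF Linfty] g_eq_iff eq_commute[of c])
  qed
  finally show ?thesis by blast
qed

end

theorem theorem4p1:
  fixes f \<phi> :: "real \<Rightarrow> real"
  assumes f_C2: "C2_fun f"
    and f_convex: "\<And>u. deriv (deriv f) u \<ge> 0"
    and f_null: "emeasure lebesgue {u. deriv (deriv f) u = 0} = 0"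
    and phi_Linfty: "Linfty_fun \<phi>"
  shows
    "(\<forall>x t. cont_shock_gen_point f \<phi> x t \<longrightarrow>
        (\<exists>x0 c. c \<in> char_values f \<phi> x0 \<and> 0 < t \<and> tp f \<phi> x0 c = ereal t
           \<and> x = x0 + t * deriv f c \<and> cont_shock_gen_point_of_char f \<phi> x0 c x t))
     \<and>
     (\<forall>x0 c. c \<in> char_values f \<phi> x0 \<longrightarrow>
        ((\<exists>t>0. tp f \<phi> x0 c = ereal t
            \<and> cont_shock_gen_point_of_char f \<phi> x0 c (x0 + t * deriv f c) t)
         \<longleftrightarrow>
         (\<exists>t>0. tp f \<phi> x0 c = ereal t
            \<and> (\<forall>l. l \<noteq> 0 \<and> (\<exists>u. l = t * (deriv f c - deriv f u)) \<longrightarrow>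
                 Phi \<phi> (x0 + l) - Phi \<phi> x0 - c * l
                   > (rho f (inv (deriv f) (deriv f c - l / t)) c - c) * l))))
     \<and>
     (\<forall>x0 c \<alpha>p Np \<gamma>m Cm.
        upper_left_Dini (Phi \<phi>) x0 < lower_right_Dini (Phi \<phi>) x0
        \<and> ereal c = upper_left_Dini (Phi \<phi>) x0 \<and> c \<in> char_values f \<phi> x0
        \<and> \<alpha>p \<ge> 0 \<and> \<gamma>m > 0 \<and> Np > 0 \<and> Cm \<noteq> 0
        \<and> flux_asymp (at_right c) f c \<alpha>p Np \<and> data_asymp (at_left 0) \<phi> x0 c \<gamma>m Cm
        \<longrightarrow>
        (0 < tp f \<phi> x0 c \<and> tp f \<phi> x0 c < \<infinity> \<longleftrightarrow> Cm < 0 \<and> \<gamma>m * (1 + \<alpha>p) = 1)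
        \<and> (0 < tp f \<phi> x0 c \<and> tp f \<phi> x0 c < \<infinity> \<longrightarrow>
             tp f \<phi> x0 c = tp_minus f \<phi> x0 c
             \<and> tp_minus f \<phi> x0 c = ereal (inverse (\<gamma>m * Np * \<bar>Cm\<bar> powr (1 + \<alpha>p)))))
     \<and>
     (\<forall>x0 c \<alpha>m Nm \<gamma>p Cp.
        upper_left_Dini (Phi \<phi>) x0 < lower_right_Dini (Phi \<phi>) x0
        \<and> ereal c = lower_right_Dini (Phi \<phi>) x0 \<and> c \<in> char_values f \<phi> x0
        \<and> \<alpha>m \<ge> 0 \<and> \<gamma>p > 0 \<and> Nm > 0 \<and> Cp \<noteq> 0
        \<and> flux_asymp (at_left c) f c \<alpha>m Nm \<and> data_asymp (at_right 0) \<phi> x0 c \<gamma>p Cp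
        \<longrightarrow>
        (0 < tp f \<phi> x0 c \<and> tp f \<phi> x0 c < \<infinity> \<longleftrightarrow> Cp < 0 \<and> \<gamma>p * (1 + \<alpha>m) = 1)
        \<and> (0 < tp f \<phi> x0 c \<and> tp f \<phi> x0 c < \<infinity> \<longrightarrow>
             tp f \<phi> x0 c = tp_plus f \<phi> x0 c
             \<and> tp_plus f \<phi> x0 c = ereal (inverse (\<gamma>p * Nm * \<bar>Cp\<bar> powr (1 + \<alpha>m)))))
     \<and>
     (\<forall>x0 c \<alpha>p \<alpha>m Np Nm \<gamma>p \<gamma>m Cp Cm.
        upper_left_Dini (Phi \<phi>) x0 = lower_right_Dini (Phi \<phi>) x0
        \<and> c \<in> char_values f \<phi> x0
        \<and> \<alpha>p \<ge> 0 \<and> \<alpha>m \<ge> 0 \<and> \<gamma>p > 0 \<and> \<gamma>m > 0 \<and> Np > 0 \<and> Nm > 0 \<and> Cp \<noteq> 0 \<and> Cm \<noteq> 0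
        \<and> flux_asymp (at_right c) f c \<alpha>p Np \<and> flux_asymp (at_left c) f c \<alpha>m Nm
        \<and> data_asymp (at_right 0) \<phi> x0 c \<gamma>p Cp \<and> data_asymp (at_left 0) \<phi> x0 c \<gamma>m Cm
        \<longrightarrow>
        (0 < tp_plus f \<phi> x0 c \<and> tp_plus f \<phi> x0 c < \<infinity> \<longleftrightarrow> Cp < 0 \<and> \<gamma>p * (1 + \<alpha>m) = 1)
        \<and> (0 < tp_minus f \<phi> x0 c \<and> tp_minus f \<phi> x0 c < \<infinity> \<longleftrightarrow> Cm < 0 \<and> \<gamma>m * (1 + \<alpha>p) = 1)
        \<and> (0 < tp_plus f \<phi> x0 c \<and> tp_plus f \<phi> x0 c < \<infinity> \<longrightarrow>
             tp_plus f \<phi> x0 c = ereal (inverse (\<gamma>p * Nm * \<bar>Cp\<bar> powr (1 + \<alpha>m))))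
        \<and> (0 < tp_minus f \<phi> x0 c \<and> tp_minus f \<phi> x0 c < \<infinity> \<longrightarrow>
             tp_minus f \<phi> x0 c = ereal (inverse (\<gamma>m * Np * \<bar>Cm\<bar> powr (1 + \<alpha>p))))
        \<and> (0 < tp f \<phi> x0 c \<and> tp f \<phi> x0 c < \<infinity> \<longrightarrow>
             (0 < tp_minus f \<phi> x0 c \<and> tp_minus f \<phi> x0 c < \<infinity> \<and> tp_plus f \<phi> x0 c = \<infinity> \<longrightarrow>
                tp f \<phi> x0 c = ereal (inverse (\<gamma>m * Np * \<bar>Cm\<bar> powr (1 + \<alpha>p))))
             \<and> (0 < tp_plus f \<phi> x0 c \<and> tp_plus f \<phi> x0 c < \<infinity> \<and> tp_minus f \<phi> x0 c = \<infinity> \<longrightarrow>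
                tp f \<phi> x0 c = ereal (inverse (\<gamma>p * Nm * \<bar>Cp\<bar> powr (1 + \<alpha>m))))
             \<and> (0 < tp_plus f \<phi> x0 c \<and> tp_plus f \<phi> x0 c < \<infinity>
                \<and> 0 < tp_minus f \<phi> x0 c \<and> tp_minus f \<phi> x0 c < \<infinity> \<longrightarrow>
                tp f \<phi> x0 c = ereal (min (inverse (\<gamma>p * Nm * \<bar>Cp\<bar> powr (1 + \<alpha>m)))
                                         (inverse (\<gamma>m * Np * \<bar>Cm\<bar> powr (1 + \<alpha>p)))))))"
proof -
  interpret convex_flux_data f \<phi>
    using assms by unfold_locales
  show ?thesis
  proof (intro conjI, goal_cases)
    case 1
    show ?case using cont_shock_gen_point_on_char by (metis cont_shock_gen_point_def)
  next
    case 2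
    show ?case using cont_shock_gen_point_of_char_iff by blast
  next
    case 3
    show ?case
    proof (intro allI impI, goal_cases)
      case (1 x0 c \<alpha>p Np \<gamma>m Cm)
      \<comment> \<open>Here \<open>c\<close> lies strictly below the lower right Dini derivative,
        so the minimum in \<open>tp\<close> is attained on the left.\<close>
      then have "tp_plus f \<phi> x0 c = \<infinity>" by (intro tp_plus_infinite) simp
      then have "tp f \<phi> x0 c = tp_minus f \<phi> x0 c" by (simp add: tp_def)
      with 1 tp_minus_asymptotics[of \<alpha>p \<gamma>m Np Cm c x0] show ?case by simp
    qed
  next
    case 4
    show ?case
    proof (intro allI impI, goal_cases)
      case (1 x0 c \<alpha>m Nm \<gamma>p Cp)
      \<comment> \<open>Here \<open>c\<close> lies strictly above the upper left Dini derivative, so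
        the minimum in \<open>tp\<close> is attained on the right.\<close>
      then have "tp_minus f \<phi> x0 c = \<infinity>" by (intro tp_minus_infinite) simp
      then have "tp f \<phi> x0 c = tp_plus f \<phi> x0 c" by (simp add: tp_def)
      with 1 tp_plus_asymptotics[of \<alpha>m \<gamma>p Nm Cp c x0] show ?case by simp
    qed
  next
    case 5
    show ?case
    proof (intro allI impI, goal_cases)
      case (1 x0 c \<alpha>p \<alpha>m Np Nm \<gamma>p \<gamma>m Cp Cm)
      have "tp f \<phi> x0 c = min (tp_plus f \<phi> x0 c) (tp_minus f \<phi> x0 c)" by (simp add: tp_def)
      with 1 tp_plus_asymptotics[of \<alpha>m \<gamma>p Nm Cp c x0] tp_minus_asymptotics[of \<alpha>p \<gamma>m Np Cm c x0]
      show ?case by (auto simp: ereal_min)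
    qed
  qed
qed

end
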